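(* Let $\varphi$ be a type I imaginary generalized Killing spinor on a Riemannian $\mathrm{spin}^c$ manifold $(M,g)$, with Dirac current $V_\varphi$ (which is then nowhere vanishing), and let $\mathcal F=\{L_p\}_{p\in M}$ be the foliation of $M$ by the leaves of $V_\varphi^\perp$. Then the spinor $\langle\varphi,\varphi\rangle^{-1/2}\,\varphi|_{L_p}$ is $\nabla^{S_{L_p}}$-parallel for any leaf $L_p\in\mathcal F$.
   Context: A Riemannian $\mathrm{spin}^c$ manifold is an oriented Riemannian manifold $(M,g)$ of dimension $n\ge 2$ with a $\mathrm{spin}^c$ structure with associated principal $S^1$-bundle $P_{S^1}$, and a fixed connection on $P_{S^1}$. $S$ is the complex spinor bundle (rank $2^{\lfloor n/2\rfloor}$), with Clifford multiplication $X\cdot Y\cdot\psi+Y\cdot X\cdot\psi=-2g(X,Y)\psi$, positive definite Hermitian metric $\langle\cdot,\cdot\rangle$ (complex linear in the first slot) with $\langle X\cdot\psi,\eta\rangle=-\langle\psi,X\cdot\eta\rangle$, and induced metric connection $\nabla^S$ compatible with Clifford multiplication and the Levi-Civita connection $\nabla$. For $n$ even, $S=S^+\oplus S^-$ orthogonally and $\nabla^S$-parallel. A non-trivial $\varphi\in\Gamma(S)$ is an imaginary generalized Killing spinor if $\nabla^S_X\varphi=iA(X)\cdot\varphi$ for all $X$, for some $g$-symmetric endomorphism field $A$ of $TM$. Its Dirac current $V_\varphi$ is the vector field with $g(V_\varphi,X)=i\langle\varphi,X\cdot\varphi\rangle$ for all $X$. The function $\langle\varphi,\varphi\rangle^2-g(V_\varphi,V_\varphi)$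 is locally constant; $\varphi$ is of type I if it vanishes everywhere. $V_\varphi$ is a closed vector field, so $V_\varphi^\perp$ is integrable; $L_p$ is the leaf through $p$. Put $\tilde E=V_\varphi/|V_\varphi|$. Each leaf $L_p$ carries the induced $\mathrm{spin}^c$ structure, with $S^1$-bundle $P_{S^1}|_{L_p}$ and restricted connection, spinor bundle $S_{L_p}\cong S|_{L_p}$ ($n$ odd) or $S_{L_p}\cong S^+|_{L_p}$ ($n$ even), Clifford multiplication $X\bullet\eta=\tilde E\cdot X\cdot\eta$ and induced connection $\nabla^{S_{L_p}}$, which satisfies $\nabla^{S_{L_p}}_X(\psi|_{L_p})=(\nabla^S_X\psi)|_{L_p}+\frac12W^{\tilde E}(X)\bullet\psi|_{L_p}$, where $W^{\tilde E}(X)=-(\nabla_X\tilde E)^\perp$ is the Weingarten map (tangential part of $-\nabla_X\tilde E$). The restriction $\psi|_{L_p}$ of $\psi\in\Gamma(S)$ means the restriction of $\psi$ if $n$ is odd and of its $S^+$-component $\psi^+$ if $n$ is even.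
   Formalization: M is not assumed connected, so "nowhere vanishing" is stated per component: the Dirac current has no zero on any connected component of M where the spinor is not identically zero (on a disconnected M the spinor could vanish on a whole component). For connected M this is the claim as stated. *)

theory Defs
  imports "HOL-Analysis.Analysis"
begin

section \<open>Smooth maps between open subsets of normed spaces\<close>

primrec Ck_on :: "nat \<Rightarrow> ('a::real_normed_vector \<Rightarrow> 'b::real_normed_vector) \<Rightarrow> 'a set \<Rightarrow> bool" where
  "Ck_on 0 f S \<longleftrightarrow> continuous_on S f"
| "Ck_on (Suc k) f S \<longleftrightarrow>
     f differentiable_on S \<and> (\<forall>v. Ck_on k (\<lambda>x. frechet_derivative f (at x) v) S)"

text \<open>Used on open subsets of finite-dimensional spaces only, where it is the usual notion.\<close>

definition smooth_on :: "('a::real_normed_vector \<Rightarrow> 'b::real_normed_vector) \<Rightarrow> 'a set \<Rightarrow> bool" where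
  "smooth_on f S \<longleftrightarrow> (\<forall>k. Ck_on k f S)"


section \<open>Oriented Riemannian manifolds\<close>

text \<open>
  The manifold is the topological space \<open>'m\<close>, its dimension is \<open>CARD('n)\<close>. Bundles are coordinate
  bundles: everything is trivialised over one open cover by chart domains. This is no restriction,
  since a cover can be refined so as to trivialise all the bundles involved, and since patches may be
  empty or repeated, so that any index set can be extended to a whole type. A tangent vector at \<open>p\<close> is given in the
  chart \<open>i\<close> by its components in \<open>real ^ 'n\<close>; a tensor field or a section is the family, indexed
  by \<open>i\<close>, of its local representatives, of which only the values on the patch \<open>i\<close> matter.
\<close>

record ('m, 'i, 'n::finite) riemannian =
  patch :: "'i \<Rightarrow> 'm set"
  chart :: "'i \<Rightarrow> 'm \<Rightarrow> real ^ 'n"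
  metric :: "'i \<Rightarrow> 'm \<Rightarrow> real ^ 'n ^ 'n"
  christoffel :: "'i \<Rightarrow> 'm \<Rightarrow> real ^ 'n \<Rightarrow> real ^ 'n \<Rightarrow> real ^ 'n"

type_synonym ('m, 'i, 'n) vector_field = "'i \<Rightarrow> 'm \<Rightarrow> real ^ 'n"
type_synonym ('m, 'i, 'n) endo_field = "'i \<Rightarrow> 'm \<Rightarrow> real ^ 'n ^ 'n"
type_synonym ('m, 'i, 's) spinor_field = "'i \<Rightarrow> 'm \<Rightarrow> complex ^ 's"

definition inv_chart :: "('m, 'i, 'n::finite, 'z) riemannian_scheme \<Rightarrow> 'i \<Rightarrow> real ^ 'n \<Rightarrow> 'm" where
  "inv_chart M i = inv_into (patch M i) (chart M i)"

definition smooth_in ::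
  "('m, 'i, 'n::finite, 'z) riemannian_scheme \<Rightarrow> 'i \<Rightarrow> 'm set \<Rightarrow> ('m \<Rightarrow> 'b::real_normed_vector) \<Rightarrow> bool"
  where "smooth_in M i W f \<longleftrightarrow> smooth_on (f \<circ> inv_chart M i) (chart M i ` W)"

text \<open>Derivative of a local function \<open>f\<close> at \<open>p\<close> in the direction with components \<open>v\<close> in the chart \<open>i\<close>.\<close>

definition deriv_in ::
  "('m, 'i, 'n::finite, 'z) riemannian_scheme \<Rightarrow> 'i \<Rightarrow> ('m \<Rightarrow> 'b::real_normed_vector)
    \<Rightarrow> 'm \<Rightarrow> real ^ 'n \<Rightarrow> 'b"
  where "deriv_in M i f p v = frechet_derivative (f \<circ> inv_chart M i) (at (chart M i p)) v"

text \<open>Transformation of the components of a tangent vector from the chart \<open>i\<close> to the chart \<open>j\<close>.\<close>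

definition jac ::
  "('m, 'i, 'n::finite, 'z) riemannian_scheme \<Rightarrow> 'i \<Rightarrow> 'i \<Rightarrow> 'm \<Rightarrow> real ^ 'n \<Rightarrow> real ^ 'n"
  where "jac M i j p v = deriv_in M i (chart M j) p v"

definition ip ::
  "('m, 'i, 'n::finite, 'z) riemannian_scheme \<Rightarrow> 'i \<Rightarrow> 'm \<Rightarrow> real ^ 'n \<Rightarrow> real ^ 'n \<Rightarrow> real"
  where "ip M i p v w = v \<bullet> (metric M i p *v w)"

definition oriented_atlas ::
  "('m::{t2_space,second_countable_topology}, 'i, 'n::finite, 'z) riemannian_scheme \<Rightarrow> bool"
  where "oriented_atlas M \<longleftrightarrow>
    (\<Union>i. patch M i) = UNIV \<and>
    (\<forall>i. open (patch M i) \<and> open (chart M i ` patch M i) \<and>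
         homeomorphism (patch M i) (chart M i ` patch M i) (chart M i) (inv_chart M i)) \<and>
    (\<forall>i j. smooth_in M i (patch M i \<inter> patch M j) (chart M j)) \<and>
    (\<forall>i j. \<forall>p \<in> patch M i \<inter> patch M j. 0 < det (matrix (jac M i j p)))"

definition riemannian_metric :: "('m, 'i, 'n::finite, 'z) riemannian_scheme \<Rightarrow> bool" where
  "riemannian_metric M \<longleftrightarrow>
    (\<forall>i. smooth_in M i (patch M i) (metric M i)) \<and>
    (\<forall>i. \<forall>p \<in> patch M i. (\<forall>v w. ip M i p v w = ip M i p w v) \<and> (\<forall>v. v \<noteq> 0 \<longrightarrow> 0 < ip M i p v v)) \<and>
    (\<forall>i j. \<forall>p \<in> patch M i \<inter> patch M j. \<forall>v w.
       ip M j p (jac M i j p v) (jac M i j p w) = ip M i p v w)"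

text \<open>
  The field \<^const>\<open>christoffel\<close> contains the Christoffel symbols of the torsion-free metric
  connection. These conditions determine it on the patches; its smoothness and its transformation
  law are consequences.
\<close>

definition levi_civita :: "('m, 'i, 'n::finite, 'z) riemannian_scheme \<Rightarrow> bool" where
  "levi_civita M \<longleftrightarrow> (\<forall>i. \<forall>p \<in> patch M i.
     bilinear (christoffel M i p) \<and>
     (\<forall>u v. christoffel M i p u v = christoffel M i p v u) \<and>
     (\<forall>u v w. deriv_in M i (\<lambda>q. ip M i q v w) p u =
        ip M i p (christoffel M i p u v) w + ip M i p v (christoffel M i p u w)))"

definition nabla ::
  "('m, 'i, 'n::finite, 'z) riemannian_scheme \<Rightarrow> 'i \<Rightarrow> ('m \<Rightarrow> real ^ 'n) \<Rightarrow> 'm \<Rightarrow> real ^ 'n \<Rightarrow> real ^ 'n"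
  where "nabla M i Y p v = deriv_in M i Y p v + christoffel M i p v (Y p)"

definition symmetric_endo_field ::
  "('m, 'i, 'n::finite, 'z) riemannian_scheme \<Rightarrow> ('m, 'i, 'n) endo_field \<Rightarrow> bool"
  where "symmetric_endo_field M A \<longleftrightarrow>
    (\<forall>i. smooth_in M i (patch M i) (A i)) \<and>
    (\<forall>i j. \<forall>p \<in> patch M i \<inter> patch M j. \<forall>v. A j p *v jac M i j p v = jac M i j p (A i p *v v)) \<and>
    (\<forall>i. \<forall>p \<in> patch M i. \<forall>v w. ip M i p (A i p *v v) w = ip M i p v (A i p *v w))"


section \<open>The complex spinor module and the group Spin-c(n)\<close>

definition hprod :: "complex ^ 's \<Rightarrow> complex ^ 's \<Rightarrow> complex" where
  "hprod x y = (\<Sum>s\<in>UNIV. x $ s * cnj (y $ s))"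

text \<open>
  The matrices \<open>c a\<close> represent an orthonormal basis. Since the module has the minimal
  dimension \<open>2 ^ (n div 2)\<close>, it is irreducible. For odd \<open>n\<close> there are two
  inequivalent such modules (the sign by which the volume element acts); either is allowed.
\<close>

definition spinor_module :: "('n::finite \<Rightarrow> complex ^ 's ^ 's) \<Rightarrow> bool" where
  "spinor_module c \<longleftrightarrow>
    CARD('s) = 2 ^ (CARD('n) div 2) \<and>
    (\<forall>a b. c a ** c b + c b ** c a = (if a = b then mat (- 2) else 0)) \<and>
    (\<forall>a x y. hprod (c a *v x) y = - hprod x (c a *v y))"

definition clif :: "('n::finite \<Rightarrow> complex ^ 's ^ 's) \<Rightarrow> real ^ 'n \<Rightarrow> complex ^ 's ^ 's" where
  "clif c x = (\<Sum>a\<in>UNIV. x $ a *\<^sub>R c a)"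

text \<open>
  The complex volume element. For even \<open>n\<close> it is an involution, and its eigenspaces for
  \<open>1\<close> and \<open>- 1\<close> are the half spinor modules.
\<close>

definition volume_element :: "('n::{finite,linorder} \<Rightarrow> complex ^ 's ^ 's) \<Rightarrow> complex ^ 's ^ 's" where
  "volume_element c = mat (\<i> ^ ((CARD('n) + 1) div 2)) **
     foldr (\<lambda>a B. c a ** B) (sorted_list_of_set (UNIV :: 'n set)) (mat 1)"

definition plus_part :: "('n::{finite,linorder} \<Rightarrow> complex ^ 's ^ 's) \<Rightarrow> complex ^ 's \<Rightarrow> complex ^ 's" where
  "plus_part c x = (1 / 2) *\<^sub>R (x + volume_element c *v x)"

text \<open>
  The spinor representation is faithful on Spin(n) and on Spin-c(n), so these groups are realised
  as groups of matrices.
\<close>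

definition spin_group :: "('n::finite \<Rightarrow> complex ^ 's ^ 's) \<Rightarrow> (complex ^ 's ^ 's) set" where
  "spin_group c = {foldr (\<lambda>x B. clif c x ** B) xs (mat 1) | xs.
     even (length xs) \<and> (\<forall>x \<in> set xs. norm x = 1)}"

text \<open>
  \<open>spinc_cover c T R z\<close>: the matrix \<open>T\<close> is an element of Spin-c(n), and its image under the
  two-fold covering onto \<open>SO(n) \<times> S\<^sup>1\<close> is the pair of \<open>R\<close> and \<open>z\<close>.
\<close>

definition spinc_cover ::
  "('n::finite \<Rightarrow> complex ^ 's ^ 's) \<Rightarrow> complex ^ 's ^ 's \<Rightarrow> real ^ 'n ^ 'n \<Rightarrow> complex \<Rightarrow> bool"
  where "spinc_cover c T R z \<longleftrightarrow> (\<exists>t. \<exists>S \<in> spin_group c.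
     cmod t = 1 \<and> T = mat t ** S \<and> z = t\<^sup>2 \<and> (\<forall>x. clif c (R *v x) ** S = S ** clif c x))"


section \<open>Riemannian spin-c manifolds\<close>

text \<open>
  A spin-c structure is given by local sections \<open>s\<^sub>i\<close> of the principal Spin-c(n)-bundle over
  oriented orthonormal frames \<open>frame i\<close>, with \<open>s\<^sub>j = s\<^sub>i \<cdot> spinc_trans i j\<close>. The associated
  \<open>S\<^sup>1\<close>-bundle has the cocycle \<open>line_trans\<close>, and \<open>line_conn i\<close> is the (imaginary) local
  form of its connection, pulled back along the local section induced by \<open>s\<^sub>i\<close>.
\<close>

record ('m, 'i, 'n::finite, 's::finite) spinc_manifold = "('m, 'i, 'n) riemannian" +
  spin_rep :: "'n \<Rightarrow> complex ^ 's ^ 's"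
  frame :: "'i \<Rightarrow> 'm \<Rightarrow> 'n \<Rightarrow> real ^ 'n"
  spinc_trans :: "'i \<Rightarrow> 'i \<Rightarrow> 'm \<Rightarrow> complex ^ 's ^ 's"
  line_trans :: "'i \<Rightarrow> 'i \<Rightarrow> 'm \<Rightarrow> complex"
  line_conn :: "'i \<Rightarrow> 'm \<Rightarrow> real ^ 'n \<Rightarrow> complex"

definition oriented_orthonormal_frames :: "('m, 'i, 'n::finite, 's::finite) spinc_manifold \<Rightarrow> bool" where
  "oriented_orthonormal_frames M \<longleftrightarrow> (\<forall>i.
     (\<forall>a. smooth_in M i (patch M i) (\<lambda>p. frame M i p a)) \<and>
     (\<forall>p \<in> patch M i.
        (\<forall>a b. ip M i p (frame M i p a) (frame M i p b) = (if a = b then 1 else 0)) \<and>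
        0 < det (\<chi> a. frame M i p a)))"

definition spinc_structure :: "('m, 'i, 'n::finite, 's::finite) spinc_manifold \<Rightarrow> bool" where
  "spinc_structure M \<longleftrightarrow>
    (\<forall>i j. smooth_in M i (patch M i \<inter> patch M j) (spinc_trans M i j) \<and>
           smooth_in M i (patch M i \<inter> patch M j) (line_trans M i j)) \<and>
    (\<forall>i j. \<forall>p \<in> patch M i \<inter> patch M j. \<exists>R.
       (\<forall>a. frame M j p a = jac M i j p (\<Sum>b\<in>UNIV. R $ b $ a *\<^sub>R frame M i p b)) \<and>
       spinc_cover (spin_rep M) (spinc_trans M i j p) R (line_trans M i j p)) \<and>
    (\<forall>i j k. \<forall>p \<in> patch M i \<inter> patch M j \<inter> patch M k.
       spinc_trans M i j p ** spinc_trans M j k p = spinc_trans M i k p \<and>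
       line_trans M i j p * line_trans M j k p = line_trans M i k p)"

definition line_bundle_connection :: "('m, 'i, 'n::finite, 's::finite) spinc_manifold \<Rightarrow> bool" where
  "line_bundle_connection M \<longleftrightarrow>
    (\<forall>i. (\<forall>v. smooth_in M i (patch M i) (\<lambda>p. line_conn M i p v)) \<and>
         (\<forall>p \<in> patch M i. linear (line_conn M i p) \<and> (\<forall>v. Re (line_conn M i p v) = 0))) \<and>
    (\<forall>i j. \<forall>p \<in> patch M i \<inter> patch M j. \<forall>v.
       line_conn M j p (jac M i j p v) =
         line_conn M i p v + deriv_in M i (line_trans M i j) p v / line_trans M i j p)"

definition riemannian_spinc_manifold ::
  "('m::{t2_space,second_countable_topology}, 'i, 'n::finite, 's::finite) spinc_manifold \<Rightarrow> bool"
  where "riemannian_spinc_manifold M \<longleftrightarrow>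
    2 \<le> CARD('n) \<and> oriented_atlas M \<and> riemannian_metric M \<and> levi_civita M \<and>
    spinor_module (spin_rep M) \<and> oriented_orthonormal_frames M \<and>
    spinc_structure M \<and> line_bundle_connection M"


section \<open>Spinor fields\<close>

text \<open>The field is the class of \<open>s\<^sub>i\<close> and \<open>\<phi> i\<close> in the associated bundle \<open>S\<close>.\<close>

definition spinor_section ::
  "('m, 'i, 'n::finite, 's::finite) spinc_manifold \<Rightarrow> ('m, 'i, 's) spinor_field \<Rightarrow> bool"
  where "spinor_section M \<phi> \<longleftrightarrow>
    (\<forall>i. smooth_in M i (patch M i) (\<phi> i)) \<and>
    (\<forall>i j. \<forall>p \<in> patch M i \<inter> patch M j. \<phi> i p = spinc_trans M i j p *v \<phi> j p)"

definition cmult ::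
  "('m, 'i, 'n::finite, 's::finite) spinc_manifold \<Rightarrow> 'i \<Rightarrow> 'm \<Rightarrow> real ^ 'n \<Rightarrow> complex ^ 's \<Rightarrow> complex ^ 's"
  where "cmult M i p v x = clif (spin_rep M) (\<chi> a. ip M i p v (frame M i p a)) *v x"

text \<open>
  The local connection form of the spinor bundle, i.e. the lift to Spin-c(n) of the
  Levi-Civita connection form together with the connection of the \<open>S\<^sup>1\<close>-bundle; the factor
  \<open>1 / 2\<close> in front of the latter is due to the squaring map in the covering.
\<close>

definition spin_conn ::
  "('m, 'i, 'n::finite, 's::finite) spinc_manifold \<Rightarrow> 'i \<Rightarrow> 'm \<Rightarrow> real ^ 'n \<Rightarrow> complex ^ 's ^ 's"
  where "spin_conn M i p v =
    (1 / 4) *\<^sub>R (\<Sum>a\<in>UNIV. \<Sum>b\<in>UNIV.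
        ip M i p (nabla M i (\<lambda>q. frame M i q a) p v) (frame M i p b) *\<^sub>R
          (spin_rep M a ** spin_rep M b))
    + mat (line_conn M i p v / 2)"

definition spin_nabla ::
  "('m, 'i, 'n::finite, 's::finite) spinc_manifold \<Rightarrow> ('m, 'i, 's) spinor_field
    \<Rightarrow> 'i \<Rightarrow> 'm \<Rightarrow> real ^ 'n \<Rightarrow> complex ^ 's"
  where "spin_nabla M \<phi> i p v = deriv_in M i (\<phi> i) p v + spin_conn M i p v *v \<phi> i p"

definition imaginary_generalized_killing ::
  "('m, 'i, 'n::finite, 's::finite) spinc_manifold \<Rightarrow> ('m, 'i, 's) spinor_field \<Rightarrow> bool"
  where "imaginary_generalized_killing M \<phi> \<longleftrightarrow>
    spinor_section M \<phi> \<and> (\<exists>i. \<exists>p \<in> patch M i. \<phi> i p \<noteq> 0) \<and>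
    (\<exists>A. symmetric_endo_field M A \<and>
       (\<forall>i. \<forall>p \<in> patch M i. \<forall>v. spin_nabla M \<phi> i p v = \<i> *s cmult M i p (A i p *v v) (\<phi> i p)))"

definition dirac_current ::
  "('m, 'i, 'n::finite, 's::finite) spinc_manifold \<Rightarrow> ('m, 'i, 's) spinor_field \<Rightarrow> ('m, 'i, 'n) vector_field"
  where "dirac_current M \<phi> i p =
    (THE v. \<forall>w. complex_of_real (ip M i p v w) = \<i> * hprod (\<phi> i p) (cmult M i p w (\<phi> i p)))"

definition type_I ::
  "('m, 'i, 'n::finite, 's::finite) spinc_manifold \<Rightarrow> ('m, 'i, 's) spinor_field \<Rightarrow> bool"
  where "type_I M \<phi> \<longleftrightarrow> (\<forall>i. \<forall>p \<in> patch M i.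
    (hprod (\<phi> i p) (\<phi> i p))\<^sup>2
      - complex_of_real (ip M i p (dirac_current M \<phi> i p) (dirac_current M \<phi> i p)) = 0)"

definition normalized :: "('m, 'i, 's::finite) spinor_field \<Rightarrow> ('m, 'i, 's) spinor_field" where
  "normalized \<phi> i p = (Re (hprod (\<phi> i p) (\<phi> i p)) powr (- 1 / 2)) *\<^sub>R \<phi> i p"


section \<open>The leaves orthogonal to a vector field\<close>

text \<open>
  A plaque is an injectively immersed connected open piece of \<open>real ^ 'k\<close> which is tangent to the
  distribution orthogonal to \<open>V\<close>. The leaf through \<open>p\<close> consists of the points which can be joined
  to \<open>p\<close> by a chain of plaques, and the plaques contained in it are its local parametrisations.
\<close>

type_synonym ('m, 'k) plaque = "(real ^ 'k) set \<times> (real ^ 'k \<Rightarrow> 'm)"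

definition push ::
  "('m, 'i, 'n::finite, 'z) riemannian_scheme \<Rightarrow> (real ^ 'k::finite \<Rightarrow> 'm)
    \<Rightarrow> 'i \<Rightarrow> real ^ 'k \<Rightarrow> real ^ 'k \<Rightarrow> real ^ 'n"
  where "push M \<sigma> i u w = frechet_derivative (chart M i \<circ> \<sigma>) (at u) w"

definition plaques ::
  "('m::topological_space, 'i, 'n::finite, 'z) riemannian_scheme \<Rightarrow> ('m, 'i, 'n) vector_field
    \<Rightarrow> ('m, 'k::finite) plaque set"
  where "plaques M V = {(B, \<sigma>).
    open B \<and> connected B \<and> continuous_on B \<sigma> \<and> inj_on \<sigma> B \<and>
    (\<forall>i. smooth_on (chart M i \<circ> \<sigma>) {u \<in> B. \<sigma> u \<in> patch M i}) \<and>
    (\<forall>i. \<forall>u \<in> B. \<sigma> u \<in> patch M i \<longrightarrow>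
       inj (push M \<sigma> i u) \<and> range (push M \<sigma> i u) = {v. ip M i (\<sigma> u) (V i (\<sigma> u)) v = 0})}"

definition leaf :: "('m, 'k::finite) plaque set \<Rightarrow> 'm \<Rightarrow> 'm set" where
  "leaf P p = {q. (\<lambda>x y. \<exists>(B, \<sigma>) \<in> P. x \<in> \<sigma> ` B \<and> y \<in> \<sigma> ` B)\<^sup>*\<^sup>* p q}"

definition unit_normal ::
  "('m, 'i, 'n::finite, 'z) riemannian_scheme \<Rightarrow> ('m, 'i, 'n) vector_field \<Rightarrow> ('m, 'i, 'n) vector_field"
  where "unit_normal M V i p = (1 / sqrt (ip M i p (V i p) (V i p))) *\<^sub>R V i p"

definition weingarten ::
  "('m, 'i, 'n::finite, 'z) riemannian_scheme \<Rightarrow> ('m, 'i, 'n) vector_field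
    \<Rightarrow> 'i \<Rightarrow> 'm \<Rightarrow> real ^ 'n \<Rightarrow> real ^ 'n"
  where "weingarten M V i p v =
    (let E = unit_normal M V; Z = nabla M i (E i) p v
     in - (Z - ip M i p Z (E i p) *\<^sub>R E i p))"

definition leaf_cmult ::
  "('m, 'i, 'n::finite, 's::finite) spinc_manifold \<Rightarrow> ('m, 'i, 'n) vector_field
    \<Rightarrow> 'i \<Rightarrow> 'm \<Rightarrow> real ^ 'n \<Rightarrow> complex ^ 's \<Rightarrow> complex ^ 's"
  where "leaf_cmult M V i p v x = cmult M i p (unit_normal M V i p) (cmult M i p v x)"

text \<open>
  The spinor bundle of a leaf is the restriction of \<open>S\<close> (\<open>n\<close> odd) or of its positive half (\<open>n\<close> even).
\<close>

definition leaf_restriction ::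
  "('m, 'i, 'n::{finite,linorder}, 's::finite) spinc_manifold \<Rightarrow> ('m, 'i, 's) spinor_field
    \<Rightarrow> ('m, 'i, 's) spinor_field"
  where "leaf_restriction M \<psi> i p =
    (if odd CARD('n) then \<psi> i p else plus_part (spin_rep M) (\<psi> i p))"

text \<open>
  The induced connection on the spinor bundle of a leaf. The field \<open>\<eta>\<close> needs to be given along the
  leaf only and is differentiated in the parameters of a plaque \<open>\<sigma>\<close>: the result is the pullback of
  the connection of \<open>S\<close>, corrected by half the Weingarten term of the spinorial Gauss formula.
  That formula determines the induced connection, since every section over the leaf extends locally.
\<close>

definition leaf_nabla ::
  "('m, 'i, 'n::finite, 's::finite) spinc_manifold \<Rightarrow> ('m, 'i, 'n) vector_field
    \<Rightarrow> ('m, 'i, 's) spinor_field \<Rightarrow> (real ^ 'k::finite \<Rightarrow> 'm)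
    \<Rightarrow> 'i \<Rightarrow> real ^ 'k \<Rightarrow> real ^ 'k \<Rightarrow> complex ^ 's"
  where "leaf_nabla M V \<eta> \<sigma> i u w =
    (let p = \<sigma> u; v = push M \<sigma> i u w
     in frechet_derivative (\<lambda>x. \<eta> i (\<sigma> x)) (at u) w + spin_conn M i p v *v \<eta> i p
        + (1 / 2) *\<^sub>R leaf_cmult M V i p (weingarten M V i p v) (\<eta> i p))"

text \<open>
  Differentiability is included so that the derivative in \<^const>\<open>leaf_nabla\<close> is meaningful.
\<close>

definition parallel_on_leaf ::
  "('m, 'i, 'n::finite, 's::finite) spinc_manifold \<Rightarrow> ('m, 'i, 'n) vector_field
    \<Rightarrow> ('m, 'k::finite) plaque set \<Rightarrow> 'm set \<Rightarrow> ('m, 'i, 's) spinor_field \<Rightarrow> bool"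
  where "parallel_on_leaf M V P L \<eta> \<longleftrightarrow>
    (\<forall>(B, \<sigma>) \<in> P. \<sigma> ` B \<subseteq> L \<longrightarrow>
       (\<forall>i. \<forall>u \<in> B. \<sigma> u \<in> patch M i \<longrightarrow>
          (\<lambda>x. \<eta> i (\<sigma> x)) differentiable (at u) \<and> (\<forall>w. leaf_nabla M V \<eta> \<sigma> i u w = 0)))"

end

theory Submission
  imports Defs
begin

text \<open>
  Write \<open>f = \<langle>\<phi>,\<phi>\<rangle>\<close> and let \<open>V\<close> be the Dirac current. Type I says \<open>g(V,V) = f\<^sup>2\<close>, and this is the equality
  case of the Cauchy-Schwarz inequality \<open>g(V,V) = \<langle>i\<phi>, V\<cdot>\<phi>\<rangle> \<le> |\<phi>| |V\<cdot>\<phi>|\<close>. Hence the unit normal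
  \<open>E = V / f\<close> satisfies \<open>E\<cdot>\<phi> = i\<phi>\<close> (\<open>cmult_unit_normal\<close>). Everything follows by differentiating
  this one equation with the compatible connection, where \<open>\<nabla>\<^sub>X\<phi> = i a\<cdot>\<phi>\<close> and \<open>a = A(X)\<close>:
  \<open>(\<nabla>\<^sub>X E)\<cdot>\<phi> = i\<nabla>\<^sub>X\<phi> - E\<cdot>\<nabla>\<^sub>X\<phi> = - 2 a\<cdot>\<phi> + 2 g(E,a) E\<cdot>\<phi>\<close>.
  A nonzero tangent vector acts injectively on spinors, so \<open>\<nabla>\<^sub>X E = -2 (a - g(E,a)E)\<close>
  (\<open>nabla_unit_normal\<close>), which identifies the Weingarten map as twice the tangential part of \<open>A\<close>. Since
  the connection is metric, \<open>X f = -2 f g(E,a)\<close> (\<open>spinor_inner_deriv\<close>). Inserted into the spinorial Gauss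
  formula for \<open>\<phi> / \<surd>f\<close>, the derivative of the factor contributes \<open>g(E,a)\<close> times the spinor, the Killing
  equation \<open>i a\<cdot>\<phi>\<close>, and the Weingarten term \<open>E\<cdot>(a - g(E,a)E)\<cdot>\<phi> = - i a\<cdot>\<phi> - g(E,a)\<phi>\<close>; the
  sum is zero (\<open>normalized_parallel\<close>). For even dimension the projection to half spinors commutes with
  everything of even Clifford degree, so it preserves parallelism.

  That \<open>V\<close> has no zero on a component where \<open>\<phi>\<close> is not identically zero amounts to the same statement for
  \<open>\<phi>\<close>: \<open>|X f| \<le> K |X| f\<close> locally, so \<open>f\<close> vanishes near each of its zeros, and the zero set is open as
  well as closed (\<open>nonzero_on_connected_component\<close>). On a component where \<open>\<phi>\<close> vanishes there are no
  plaques at all, for dimension reasons (\<open>plaque_normal_nonzero\<close>).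
\<close>

section \<open>Clifford algebra on the spinor module\<close>

text \<open>
  All computations use the real inner product, for which both multiplication by \<open>i\<close> and Clifford
  multiplication are skew; where \<open>i\<langle>x,y\<rangle>\<close> is real, it is the inner product of \<open>ix\<close> and \<open>y\<close>.
\<close>

lemma inner_eq_Re_hprod: "x \<bullet> y = Re (hprod x y)"
  by (simp add: inner_vec_def hprod_def inner_complex_def)

lemma hprod_self: "hprod x x = complex_of_real ((norm x)\<^sup>2)"
proof -
  have "complex_of_real ((norm x)\<^sup>2) = (\<Sum>s\<in>UNIV. complex_of_real (x $ s \<bullet> x $ s))"
    by (simp add: power2_norm_eq_inner inner_vec_def)
  also have "\<dots> = (\<Sum>s\<in>UNIV. x $ s * cnj (x $ s))"
    by (intro sum.cong refl)
      (simp add: complex_mult_cnj inner_complex_def power2_eq_square)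
  finally show ?thesis by (simp add: hprod_def)
qed

lemma smult_i_smult_i: "\<i> *s (\<i> *s (x :: complex ^ 's)) = - x"
  by (simp add: vector_smult_assoc vec_eq_iff)

lemma smult_i_skew: "(\<i> *s x) \<bullet> y = - (x \<bullet> (\<i> *s (y :: complex ^ 's)))"
  by (simp add: inner_vec_def inner_complex_def sum_negf[symmetric])

lemma smult_i_scaleR: "\<i> *s (r *\<^sub>R x) = r *\<^sub>R (\<i> *s (x :: complex ^ 's))"
  by (simp add: vec_eq_iff)

lemma smult_i_diff: "\<i> *s (x - y) = \<i> *s x - \<i> *s (y :: complex ^ 's)"
  by (simp add: vec_eq_iff algebra_simps)

lemma linear_smult_i: "linear ((*s) \<i> :: complex ^ 's \<Rightarrow> complex ^ 's)"
  by (rule linearI) (simp_all add: vec_eq_iff algebra_simps)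

lemma mat_smult: "mat t *v x = (t :: complex) *s (x :: complex ^ 's)"
  by (simp add: matrix_vector_mult_def mat_def vec_eq_iff if_distrib if_distribR cong: if_cong)

lemma matrix_smult_i: "A *v (\<i> *s x) = \<i> *s (A *v (x :: complex ^ 's))"
  by (rule vector_scalar_commute)

lemma matrix_vector_scaleR_left: "(r *\<^sub>R A) *v x = r *\<^sub>R (A *v (x :: complex ^ 's))"
  by (simp add: matrix_vector_mult_def vec_eq_iff scaleR_sum_right)

lemma matrix_vector_sum_left: "(\<Sum>a\<in>I. A a) *v x = (\<Sum>a\<in>I. A a *v (x :: complex ^ 's))"
  by (induction I rule: infinite_finite_induct)
    (simp_all add: matrix_vector_mult_add_rdistrib)

lemma matrix_vector_scaleR_right: "A *v (r *\<^sub>R x) = r *\<^sub>R (A *v (x :: complex ^ 's))"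
  by (simp add: matrix_vector_mult_def vec_eq_iff scaleR_sum_right)

lemma matrix_vector_sum_right: "A *v (\<Sum>a\<in>I. f a) = (\<Sum>a\<in>I. A *v (f a :: complex ^ 's))"
  by (rule linear_sum) simp

lemma clif_apply: "clif c u *v x = (\<Sum>a\<in>UNIV. u $ a *\<^sub>R (c a *v x))"
  by (simp add: clif_def matrix_vector_sum_left matrix_vector_scaleR_left)

lemma linear_clif: "linear (\<lambda>u. clif c u *v x)"
  by (rule linearI)
    (simp_all add: clif_apply algebra_simps sum.distrib scaleR_sum_right)

context
  fixes c :: "'n::finite \<Rightarrow> complex ^ 's ^ 's"
  assumes c: "spinor_module c"
begin

lemma generator_anticommute:
  "c a *v (c b *v x) = - (c b *v (c a *v x)) - (if a = b then 2 else 0) *\<^sub>R x"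
proof -
  have "(c a ** c b + c b ** c a) *v x = (if a = b then mat (- 2) else 0) *v x"
    using c by (simp add: spinor_module_def)
  moreover have "mat (- 2) *v x = (- 2) *\<^sub>R x"
    by (simp add: mat_smult vec_eq_iff scaleR_conv_of_real)
  ultimately show ?thesis
    by (auto simp: matrix_vector_mult_add_rdistrib matrix_vector_mul_assoc[symmetric] algebra_simps
        eq_neg_iff_add_eq_0 split: if_splits)
qed

lemma generator_skew: "(c a *v x) \<bullet> y = - (x \<bullet> (c a *v y))"
  using c by (simp add: spinor_module_def inner_eq_Re_hprod)

lemma clif_skew: "(clif c u *v x) \<bullet> y = - (x \<bullet> (clif c u *v y))"
  by (simp add: clif_apply inner_sum_left inner_sum_right generator_skew sum_negf)

lemma clif_anticommute:
  "clif c u *v (clif c v *v x) = - (clif c v *v (clif c u *v x)) - (2 * (u \<bullet> v)) *\<^sub>R x"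
proof -
  have "clif c u *v (clif c v *v x) =
      (\<Sum>a\<in>UNIV. \<Sum>b\<in>UNIV. (u $ a * v $ b) *\<^sub>R (c a *v (c b *v x)))"
    by (subst sum.swap) (simp add: clif_apply matrix_vector_sum_right matrix_vector_scaleR_right scaleR_sum_right mult.commute)
  also have "\<dots> = (\<Sum>a\<in>UNIV. \<Sum>b\<in>UNIV. - ((u $ a * v $ b) *\<^sub>R (c b *v (c a *v x))))
      - (\<Sum>a\<in>UNIV. \<Sum>b\<in>UNIV. (if a = b then 2 * (u $ a * v $ b) else 0) *\<^sub>R x)"
    unfolding sum_subtractf[symmetric]
    by (intro sum.cong refl, subst generator_anticommute) (simp add: algebra_simps)
  also have "(\<Sum>a\<in>UNIV. \<Sum>b\<in>UNIV. (if a = b then 2 * (u $ a * v $ b) else 0) *\<^sub>R x)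
      = (2 * (u \<bullet> v)) *\<^sub>R x"
    by (simp add: if_distrib if_distribR inner_vec_def scaleR_sum_left sum_distrib_left cong: if_cong)
  also have "(\<Sum>a\<in>UNIV. \<Sum>b\<in>UNIV. - ((u $ a * v $ b) *\<^sub>R (c b *v (c a *v x))))
      = - (clif c v *v (clif c u *v x))"
    by (simp add: clif_apply matrix_vector_sum_right matrix_vector_scaleR_right scaleR_sum_right sum_negf mult.commute)
  finally show ?thesis .
qed

lemma clif_square: "clif c u *v (clif c u *v x) = - ((u \<bullet> u) *\<^sub>R x)"
proof -
  let ?y = "clif c u *v (clif c u *v x)"
  have "?y = (1 / 2) *\<^sub>R (?y + ?y)"
    by (simp only: scaleR_half_double)
  also have "?y + ?y = ?y + (- ?y - (2 * (u \<bullet> u)) *\<^sub>R x)"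
    by (rule arg_cong[OF clif_anticommute])
  finally show ?thesis by simp
qed

text \<open>
  Multiplication by \<open>u\<close> is skew and squares to \<open>- |u|\<^sup>2\<close>. In particular it is injective for \<open>u \<noteq> 0\<close>, which
  turns identities between Clifford products into identities between vectors.
\<close>

lemma norm_clif: "norm (clif c u *v x) = norm u * norm x"
proof -
  have "(norm (clif c u *v x))\<^sup>2 = (norm u * norm x)\<^sup>2"
    by (simp add: power2_norm_eq_inner clif_skew clif_square power_mult_distrib)
  then show ?thesis by (simp add: power2_eq_iff_nonneg)
qed

text \<open>
  The left side defines the Dirac current. It is real because skewness makes \<open>\<langle>x, w\<cdot>x\<rangle>\<close> imaginary.
\<close>

lemma current_pairing:
  "\<i> * hprod x (clif c w *v x) = complex_of_real ((\<i> *s x) \<bullet> (clif c w *v x))"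
proof (rule complex_eqI)
  show "Re (\<i> * hprod x (clif c w *v x)) = Re (complex_of_real ((\<i> *s x) \<bullet> (clif c w *v x)))"
    by (simp add: inner_eq_Re_hprod hprod_def sum_distrib_left mult.assoc flip: Re_sum)
  have "x \<bullet> (clif c w *v x) = 0"
    using clif_skew[of w x x] by (simp add: inner_commute)
  then show "Im (\<i> * hprod x (clif c w *v x)) = Im (complex_of_real ((\<i> *s x) \<bullet> (clif c w *v x)))"
    by (simp add: inner_eq_Re_hprod)
qed

text \<open>
  The hypothesis is the equality case of the Cauchy-Schwarz inequality for the vectors \<open>ix\<close> and
  \<open>E\<cdot>x\<close>, which have equal norms, so the two agree.
\<close>

lemma current_eigenspinor:
  assumes E: "norm E = 1" and eq: "(\<i> *s x) \<bullet> (clif c E *v x) = (norm x)\<^sup>2"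
  shows "clif c E *v x = \<i> *s x"
proof -
  have ni: "(norm (\<i> *s x))\<^sup>2 = (norm x)\<^sup>2"
    by (simp add: power2_norm_eq_inner smult_i_skew smult_i_smult_i)
  have "(norm (clif c E *v x - \<i> *s x))\<^sup>2
      = (norm (clif c E *v x))\<^sup>2 + (norm (\<i> *s x))\<^sup>2 - 2 * ((\<i> *s x) \<bullet> (clif c E *v x))"
    by (simp add: power2_norm_eq_inner inner_diff_left inner_diff_right inner_commute)
  also have "\<dots> = 0" using E eq ni by (simp add: norm_clif)
  finally show ?thesis by simp
qed

text \<open>
  Here \<open>G\<close> stands for the connection form of the Levi-Civita connection in an orthonormal frame and \<open>t\<close> for
  that of the line bundle. In the sum, exchanging \<open>a\<close> and \<open>b\<close> changes the sign of \<open>G\<close> but not the inner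
  product \<open>x \<bullet> (c a c b x) = - (c a x) \<bullet> (c b x)\<close>.
\<close>

lemma spin_connection_skew:
  assumes G: "\<And>a b. G a b = - G b a" and t: "Re t = 0"
  defines "\<Omega> \<equiv> (1 / 4) *\<^sub>R (\<Sum>a\<in>UNIV. \<Sum>b\<in>UNIV. (G a b :: real) *\<^sub>R (c a ** c b)) + mat (t / 2)"
  shows "x \<bullet> (\<Omega> *v x) = 0"
proof -
  have 1: "mat (t / 2) *v x = (Im t / 2) *\<^sub>R (\<i> *s x)"
    using t by (simp add: mat_smult vec_eq_iff complex_eq_iff)
  have 2: "x \<bullet> (\<i> *s x) = 0" using smult_i_skew[of x x] by (simp add: inner_commute)
  let ?S = "\<Sum>a\<in>UNIV. \<Sum>b\<in>UNIV. G a b * (x \<bullet> (c a *v (c b *v x)))"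
  have "?S = (\<Sum>a\<in>UNIV. \<Sum>b\<in>UNIV. - (G b a * (x \<bullet> (c b *v (c a *v x)))))"
  proof (intro sum.cong refl)
    fix a b
    have "x \<bullet> (c a *v (c b *v x)) = x \<bullet> (c b *v (c a *v x))"
      using generator_skew[of a x "c b *v x"] generator_skew[of b x "c a *v x"]
      by (simp add: inner_commute)
    then show "G a b * (x \<bullet> (c a *v (c b *v x))) = - (G b a * (x \<bullet> (c b *v (c a *v x))))"
      using G[of a b] by simp
  qed
  also have "\<dots> = - ?S" by (subst sum.swap) (simp add: sum_negf)
  finally have 3: "?S = 0" by simp
  have "x \<bullet> (\<Omega> *v x) = 1 / 4 * ?S"
    unfolding \<Omega>_def
    by (simp add: matrix_vector_mult_add_rdistrib matrix_vector_scaleR_left matrix_vector_sum_left 1 2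
        inner_add_right inner_sum_right flip: matrix_vector_mul_assoc)
  then show ?thesis using 3 by simp
qed

text \<open>
  Infinitesimally, the double covering sends the commutator with \<open>\<Omega>\<close> to the action of \<open>G\<close> on vectors; the
  scalar part is central and drops out. This is the compatibility of the spinorial connection with
  Clifford multiplication.
\<close>

lemma spin_connection_generator:
  fixes t :: complex
  assumes G: "\<And>a b. G a b = - G b a"
  defines "\<Omega> \<equiv> (1 / 4) *\<^sub>R (\<Sum>a\<in>UNIV. \<Sum>b\<in>UNIV. (G a b :: real) *\<^sub>R (c a ** c b)) + mat (t / 2)"
  shows "\<Omega> *v (c d *v x) = c d *v (\<Omega> *v x) + (\<Sum>b\<in>UNIV. G d b *\<^sub>R (c b *v x))"
proof -
  have E: "\<Omega> *v y = (1 / 4) *\<^sub>R (\<Sum>a\<in>UNIV. \<Sum>b\<in>UNIV. G a b *\<^sub>R (c a *v (c b *v y))) + (t / 2) *s y" for y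
    unfolding \<Omega>_def
    by (simp add: matrix_vector_mult_add_rdistrib matrix_vector_scaleR_left matrix_vector_sum_left mat_smult
        flip: matrix_vector_mul_assoc)
  have move: "c a *v (c b *v (c d *v x)) = c d *v (c a *v (c b *v x))
      + (if a = d then 2 else 0) *\<^sub>R (c b *v x) - (if b = d then 2 else 0) *\<^sub>R (c a *v x)" for a b
    by (subst generator_anticommute[of b d])
      (simp add: matrix_vector_mult_diff_distrib matrix_vector_scaleR_right generator_anticommute[of a d "c b *v x"]
        vec.neg algebra_simps)
  have "(\<Sum>a\<in>UNIV. \<Sum>b\<in>UNIV. G a b *\<^sub>R (c a *v (c b *v (c d *v x))))
     = c d *v (\<Sum>a\<in>UNIV. \<Sum>b\<in>UNIV. G a b *\<^sub>R (c a *v (c b *v x)))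
       + (\<Sum>a\<in>UNIV. \<Sum>b\<in>UNIV. (if a = d then 2 * G a b else 0) *\<^sub>R (c b *v x))
       - (\<Sum>a\<in>UNIV. \<Sum>b\<in>UNIV. (if b = d then 2 * G a b else 0) *\<^sub>R (c a *v x))"
    unfolding matrix_vector_sum_right matrix_vector_scaleR_right sum.distrib[symmetric] sum_subtractf[symmetric]
    by (intro sum.cong refl, subst move) (simp add: algebra_simps)
  also have "(\<Sum>a\<in>UNIV. \<Sum>b\<in>UNIV. (if a = d then 2 * G a b else 0) *\<^sub>R (c b *v x))
      = 2 *\<^sub>R (\<Sum>b\<in>UNIV. G d b *\<^sub>R (c b *v x))"
    by (subst sum.swap) (simp add: if_distrib if_distribR scaleR_sum_right cong: if_cong)
  also have "(\<Sum>a\<in>UNIV. \<Sum>b\<in>UNIV. (if b = d then 2 * G a b else 0) *\<^sub>R (c a *v x))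
      = - (2 *\<^sub>R (\<Sum>b\<in>UNIV. G d b *\<^sub>R (c b *v x)))"
    by (subst (2) G) (simp add: if_distrib if_distribR scaleR_sum_right sum_negf[symmetric] cong: if_cong)
  finally have "(\<Sum>a\<in>UNIV. \<Sum>b\<in>UNIV. G a b *\<^sub>R (c a *v (c b *v (c d *v x))))
     = c d *v (\<Sum>a\<in>UNIV. \<Sum>b\<in>UNIV. G a b *\<^sub>R (c a *v (c b *v x)))
       + 4 *\<^sub>R (\<Sum>b\<in>UNIV. G d b *\<^sub>R (c b *v x))"
    by (simp flip: scaleR_add_left)
  then show ?thesis
    by (simp add: E matrix_vector_right_distrib matrix_vector_scaleR_right vector_scalar_commute scaleR_add_right)
qed

end

text \<open>
  Moving a generator past a product costs one sign for each factor different from it; a factor equal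
  to it commutes with it.
\<close>

lemma generator_product_commute:
  fixes c :: "'n::finite \<Rightarrow> complex ^ 's ^ 's"
  assumes c: "spinor_module c" and "distinct xs"
  defines "F \<equiv> (\<lambda>xs. foldr (\<lambda>a B. c a ** B) xs (mat 1))"
  shows "F xs *v (c a *v x) =
    (if a \<in> set xs then - ((- 1) ^ length xs) else (- 1) ^ length xs) *\<^sub>R (c a *v (F xs *v x))"
  using assms(2)
proof (induction xs)
  case Nil
  then show ?case by (simp add: F_def)
next
  case (Cons b xs)
  have step: "F (b # xs) *v y = c b *v (F xs *v y)" for y
    by (simp add: F_def matrix_vector_mul_assoc)
  have gen: "c b *v (c a *v y) = - (c a *v (c b *v y))" if "a \<noteq> b" for y
    using generator_anticommute[OF c, of b a y] that by simp
  show ?case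
    using Cons by (cases "a = b") (auto simp: step matrix_vector_scaleR_right gen vec.neg)
qed

lemma volume_element_anticommute:
  fixes c :: "'n::{finite,linorder} \<Rightarrow> complex ^ 's ^ 's"
  assumes "spinor_module c" and "even CARD('n)"
  shows "volume_element c *v (c a *v x) = - (c a *v (volume_element c *v x))"
proof -
  let ?F = "foldr (\<lambda>a B. c a ** B) (sorted_list_of_set (UNIV :: 'n set)) (mat 1)"
  have "?F *v (c a *v x) = - (c a *v (?F *v x))"
    using generator_product_commute[OF assms(1), of "sorted_list_of_set (UNIV :: 'n set)" a x] assms(2)
    by simp
  then show ?thesis
    by (simp add: volume_element_def mat_smult vector_scalar_commute vec.neg flip: matrix_vector_mul_assoc)
qed

section \<open>Frames and the Dirac current\<close>

lemma linear_ip: "linear (ip M i p v)" "linear (\<lambda>v. ip M i p v w)"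
  by (auto intro!: linearI simp: ip_def algebra_simps inner_add_right inner_add_left matrix_vector_mult_scaleR)

text \<open>
  Clifford multiplication is defined through these coordinates, and the frame makes them an isometry
  onto the standard Euclidean space.
\<close>

definition frame_coords ::
  "('m, 'i, 'n::finite, 's::finite) spinc_manifold \<Rightarrow> 'i \<Rightarrow> 'm \<Rightarrow> real ^ 'n \<Rightarrow> real ^ 'n"
  where "frame_coords M i p v = (\<chi> a. ip M i p v (frame M i p a))"

lemma linear_frame_coords: "linear (frame_coords M i p)"
  by (rule linearI)
    (simp_all add: frame_coords_def vec_eq_iff linear_add[OF linear_ip(2)] linear_scale[OF linear_ip(2)])

lemma cmult_eq: "cmult M i p v x = clif (spin_rep M) (frame_coords M i p v) *v x"
  by (simp add: cmult_def frame_coords_def)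

lemma linear_cmult: "linear (\<lambda>v. cmult M i p v x)"
  unfolding cmult_eq
  by (rule linear_compose[OF linear_frame_coords linear_clif, unfolded o_def])

lemma cmult_smult_i: "cmult M i p v (\<i> *s x) = \<i> *s cmult M i p v x"
  by (simp add: cmult_eq matrix_smult_i)

lemma cmult_scaleR: "cmult M i p v (r *\<^sub>R x) = r *\<^sub>R cmult M i p v x"
  by (simp add: cmult_eq matrix_vector_scaleR_right)

context
  fixes M :: "('m::{t2_space,second_countable_topology}, 'i, 'n::finite, 's::finite) spinc_manifold"
  assumes M: "riemannian_spinc_manifold M"
begin

lemma spinor_module_spin_rep: "spinor_module (spin_rep M)"
  using M by (simp add: riemannian_spinc_manifold_def)

context
  fixes i :: 'i and p :: 'm
  assumes p: "p \<in> patch M i"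
begin

lemma ip_commute: "ip M i p v w = ip M i p w v"
  using M p by (simp add: riemannian_spinc_manifold_def riemannian_metric_def)

lemma ip_pos: "v \<noteq> 0 \<Longrightarrow> 0 < ip M i p v v"
  using M p by (simp add: riemannian_spinc_manifold_def riemannian_metric_def)

lemma ip_frame: "ip M i p (frame M i p a) (frame M i p b) = (if a = b then 1 else 0)"
  using M p by (simp add: riemannian_spinc_manifold_def oriented_orthonormal_frames_def)

lemma frame_coords_combination: "frame_coords M i p (\<Sum>a\<in>UNIV. y $ a *\<^sub>R frame M i p a) = y"
  by (simp add: frame_coords_def vec_eq_iff linear_sum[OF linear_ip(2)] linear_scale[OF linear_ip(2)]
      ip_frame if_distrib cong: if_cong)

lemma frame_expansion: "(\<Sum>a\<in>UNIV. frame_coords M i p v $ a *\<^sub>R frame M i p a) = v"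
proof -
  have "surj (frame_coords M i p)"
    by (rule surjI[where f = "\<lambda>y. \<Sum>a\<in>UNIV. y $ a *\<^sub>R frame M i p a"])
      (rule frame_coords_combination)
  with linear_frame_coords have inj: "inj (frame_coords M i p)"
    by (rule linear_surj_imp_inj)
  have "frame_coords M i p (\<Sum>a\<in>UNIV. frame_coords M i p v $ a *\<^sub>R frame M i p a)
      = frame_coords M i p v"
    by (simp only: frame_coords_combination)
  then show ?thesis
    by (simp only: inj_eq[OF inj])
qed

lemma ip_frame_coords: "ip M i p v w = frame_coords M i p v \<bullet> frame_coords M i p w"
proof -
  have "ip M i p v w = ip M i p v (\<Sum>a\<in>UNIV. frame_coords M i p w $ a *\<^sub>R frame M i p a)"
    by (simp add: frame_expansion)
  also have "\<dots> = (\<Sum>a\<in>UNIV. frame_coords M i p w $ a * ip M i p v (frame M i p a))"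
    by (simp add: linear_sum[OF linear_ip(1)] linear_scale[OF linear_ip(1)])
  finally show ?thesis
    by (simp add: inner_vec_def frame_coords_def mult.commute)
qed

lemma ip_eqI: "(\<And>w. ip M i p u w = ip M i p v w) \<Longrightarrow> u = v"
proof (rule ccontr)
  assume "\<And>w. ip M i p u w = ip M i p v w" "u \<noteq> v"
  then show False
    using ip_pos[of "u - v"] by (simp add: linear_diff[OF linear_ip(2)])
qed

lemma frame_coords_frame: "frame_coords M i p (frame M i p a) = axis a 1"
  by (simp add: frame_coords_def vec_eq_iff ip_frame axis_def eq_commute)

lemma cmult_frame: "cmult M i p (frame M i p a) x = spin_rep M a *v x"
  by (simp add: cmult_eq frame_coords_frame clif_apply axis_def if_distrib if_distribR cong: if_cong)

lemma cmult_anticommute: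
  "cmult M i p u (cmult M i p v x) = - cmult M i p v (cmult M i p u x) - (2 * ip M i p u v) *\<^sub>R x"
  unfolding cmult_eq ip_frame_coords by (rule clif_anticommute[OF spinor_module_spin_rep])

lemma norm_cmult: "norm (cmult M i p u x) = sqrt (ip M i p u u) * norm x"
  unfolding cmult_eq ip_frame_coords
  by (simp add: norm_clif[OF spinor_module_spin_rep] norm_eq_sqrt_inner[of "frame_coords M i p u"])

lemma cmult_eq_0: "cmult M i p u x = 0 \<Longrightarrow> x \<noteq> 0 \<Longrightarrow> u = 0"
  using norm_cmult[of u x] ip_pos[of u] by force

text \<open>
  The expansion in the frame exhibits the current as a polynomial in the spinor and the frame, so it
  is differentiable together with them.
\<close>

lemma dirac_current_eq:
  "dirac_current M \<phi> i p =
    (\<Sum>a\<in>UNIV. ((\<i> *s \<phi> i p) \<bullet> (spin_rep M a *v \<phi> i p)) *\<^sub>R frame M i p a)" (is "_ = ?V")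
  and ip_dirac_current:
  "ip M i p (dirac_current M \<phi> i p) w = (\<i> *s \<phi> i p) \<bullet> cmult M i p w (\<phi> i p)"
proof -
  have V: "ip M i p ?V w = (\<i> *s \<phi> i p) \<bullet> cmult M i p w (\<phi> i p)" for w
  proof -
    have "ip M i p ?V w = (\<Sum>a\<in>UNIV. ((\<i> *s \<phi> i p) \<bullet> (spin_rep M a *v \<phi> i p)) * ip M i p w (frame M i p a))"
      by (simp add: linear_sum[OF linear_ip(2)] linear_scale[OF linear_ip(2)] ip_commute)
    then show ?thesis
      by (simp add: cmult_eq clif_apply inner_sum_right frame_coords_def mult.commute)
  qed
  have pair: "\<i> * hprod (\<phi> i p) (cmult M i p w (\<phi> i p)) =
      complex_of_real ((\<i> *s \<phi> i p) \<bullet> cmult M i p w (\<phi> i p))" for w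
    unfolding cmult_eq by (rule current_pairing[OF spinor_module_spin_rep])
  \<comment> \<open>Nondegeneracy of the metric makes the defining description of the current unique.\<close>
  show eq: "dirac_current M \<phi> i p = ?V"
    unfolding dirac_current_def pair of_real_eq_iff
    by (rule the_equality) (auto simp: V intro: ip_eqI)
  show "ip M i p (dirac_current M \<phi> i p) w = (\<i> *s \<phi> i p) \<bullet> cmult M i p w (\<phi> i p)"
    unfolding eq by (rule V)
qed

context
  fixes \<phi> :: "('m, 'i, 's) spinor_field"
  assumes type_I: "type_I M \<phi>"
begin

lemma ip_dirac_current_self:
  "ip M i p (dirac_current M \<phi> i p) (dirac_current M \<phi> i p) = (norm (\<phi> i p)) ^ 4"
proof -
  have "complex_of_real ((norm (\<phi> i p)) ^ 4)
      - complex_of_real (ip M i p (dirac_current M \<phi> i p) (dirac_current M \<phi> i p)) = 0"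
    using type_I p by (simp add: type_I_def hprod_self)
  then show ?thesis
    by (simp flip: of_real_diff of_real_power)
qed

lemma dirac_current_eq_0: "dirac_current M \<phi> i p = 0 \<longleftrightarrow> \<phi> i p = 0"
  using ip_dirac_current_self ip_pos[of "dirac_current M \<phi> i p"]
  by (auto simp: ip_def)

text \<open>
  At a zero of the spinor both sides are zero, since the inverse of zero is zero. Hence the formula
  holds on the whole patch, and to differentiate it at a nonzero point the patch need not be shrunk.
\<close>

lemma unit_normal_eq:
  "unit_normal M (dirac_current M \<phi>) i p =
     (1 / (norm (\<phi> i p))\<^sup>2) *\<^sub>R dirac_current M \<phi> i p"
proof -
  have "sqrt ((norm (\<phi> i p)) ^ 4) = (norm (\<phi> i p))\<^sup>2"
    by (rule real_sqrt_unique) simp_all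
  then show ?thesis
    by (simp add: unit_normal_def ip_dirac_current_self)
qed

lemma ip_unit_normal_self:
  assumes "\<phi> i p \<noteq> 0"
  shows "ip M i p (unit_normal M (dirac_current M \<phi>) i p) (unit_normal M (dirac_current M \<phi>) i p) = 1"
  using assms
  by (simp add: unit_normal_eq linear_scale[OF linear_ip(1)] linear_scale[OF linear_ip(2)]
      ip_dirac_current_self power2_eq_square power4_eq_xxxx)

text \<open>
  Type I turns \<open>g(V,E) = \<langle>i\<phi>, E\<cdot>\<phi>\<rangle>\<close> into \<open>|\<phi>|\<^sup>2\<close>, the largest value that it can have for a unit vector.
\<close>

lemma cmult_unit_normal: "cmult M i p (unit_normal M (dirac_current M \<phi>) i p) (\<phi> i p) = \<i> *s \<phi> i p"
proof (cases "\<phi> i p = 0")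
  case True
  then show ?thesis by (simp add: cmult_eq)
next
  case False
  let ?E = "unit_normal M (dirac_current M \<phi>) i p"
  have "(\<i> *s \<phi> i p) \<bullet> cmult M i p ?E (\<phi> i p) = ip M i p (dirac_current M \<phi> i p) ?E"
    by (simp add: ip_dirac_current)
  also have "\<dots> = (norm (\<phi> i p))\<^sup>2"
    using False by (simp add: unit_normal_eq linear_scale[OF linear_ip(1)] ip_dirac_current_self
        power2_eq_square power4_eq_xxxx)
  finally show ?thesis
    unfolding cmult_eq
    by (intro current_eigenspinor[OF spinor_module_spin_rep])
      (simp_all add: norm_eq_sqrt_inner ip_unit_normal_self[OF False] flip: ip_frame_coords)
qed

end

end

end

section \<open>Covariant derivatives in a chart\<close>

lemma bounded_bilinear_matrix_vector:
  "bounded_bilinear ((*v) :: real ^ 'n::finite ^ 'm::finite \<Rightarrow> real ^ 'n \<Rightarrow> real ^ 'm)"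
  unfolding bilinear_conv_bounded_bilinear[symmetric] bilinear_def
  by (auto intro!: linearI simp: algebra_simps matrix_vector_mult_scaleR scaleR_matrix_vector_assoc)

lemma smooth_on_imp_differentiable:
  assumes "smooth_on f S" "open S" "x \<in> S"
  shows "f differentiable (at x)"
proof -
  have "Ck_on (Suc 0) f S" using assms(1) unfolding smooth_on_def by blast
  then show ?thesis
    using assms(2,3) by (simp add: differentiable_on_def at_within_open[symmetric])
qed

lemma smooth_on_imp_continuous_on: "smooth_on f S \<Longrightarrow> continuous_on S f"
  unfolding smooth_on_def by (metis Ck_on.simps(1))

lemma smooth_in_continuous_on:
  assumes "smooth_in M i W f"
  shows "continuous_on (chart M i ` W) (\<lambda>x. f (inv_chart M i x))"
  using assms smooth_on_imp_continuous_on unfolding smooth_in_def o_def by blast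

lemma deriv_in_eqI:
  "((\<lambda>x. f (inv_chart M i x)) has_derivative D) (at (chart M i p)) \<Longrightarrow> deriv_in M i f p = D"
  unfolding deriv_in_def o_def by (metis frechet_derivative_at)

context
  fixes M :: "('m::{t2_space,second_countable_topology}, 'i, 'n::finite, 's::finite) spinc_manifold"
  assumes M: "riemannian_spinc_manifold M"
begin

lemma open_patch: "open (patch M i)"
  and open_chart_image: "open (chart M i ` patch M i)"
  and homeomorphism_chart:
    "homeomorphism (patch M i) (chart M i ` patch M i) (chart M i) (inv_chart M i)"
  using M by (simp_all add: riemannian_spinc_manifold_def oriented_atlas_def)

lemma inv_chart_chart: "p \<in> patch M i \<Longrightarrow> inv_chart M i (chart M i p) = p"
  using homeomorphism_chart by (rule homeomorphism_apply1)

lemma inv_chart_mem: "x \<in> chart M i ` patch M i \<Longrightarrow> inv_chart M i x \<in> patch M i"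
  by (auto simp: inv_chart_chart)

lemma metric_frame_smooth:
  "smooth_in M i (patch M i) (metric M i)"
  "smooth_in M i (patch M i) (\<lambda>q. frame M i q a)"
  using M by (simp_all add: riemannian_spinc_manifold_def riemannian_metric_def
      oriented_orthonormal_frames_def)

context
  fixes i :: 'i and p :: 'm
  assumes p: "p \<in> patch M i"
begin

lemma has_derivative_deriv_in:
  assumes "smooth_in M i (patch M i) f"
  shows "((\<lambda>x. f (inv_chart M i x)) has_derivative deriv_in M i f p) (at (chart M i p))"
proof -
  have "(f \<circ> inv_chart M i) differentiable (at (chart M i p))"
    using assms p by (auto intro!: smooth_on_imp_differentiable[OF _ open_chart_image] simp: smooth_in_def)
  moreover have "deriv_in M i f p = frechet_derivative (f \<circ> inv_chart M i) (at (chart M i p))"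
    by (simp add: deriv_in_def fun_eq_iff)
  ultimately show ?thesis
    by (simp add: frechet_derivative_works o_def)
qed

lemma has_derivative_cong_patch:
  assumes "((\<lambda>x. f (inv_chart M i x)) has_derivative D) (at (chart M i p))"
    and "\<And>q. q \<in> patch M i \<Longrightarrow> f q = h q"
  shows "((\<lambda>x. h (inv_chart M i x)) has_derivative D) (at (chart M i p))"
  using assms p
  by (auto intro!: has_derivative_transform_within_open[OF assms(1) open_chart_image] inv_chart_mem)

lemma linear_christoffel: "linear (christoffel M i p v)"
  using M p by (simp add: riemannian_spinc_manifold_def levi_civita_def bilinear_def)

lemma deriv_metric:
  "deriv_in M i (\<lambda>q. ip M i q v w) p u =
    ip M i p (christoffel M i p u v) w + ip M i p v (christoffel M i p u w)"
  using M p by (simp add: riemannian_spinc_manifold_def levi_civita_def)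

text \<open>
  The metric compatibility of the Christoffel symbols is known for constant coordinate fields only.
  By the product rule it carries over to the frame, whose inner products are constant.
\<close>

lemma nabla_frame_skew:
  "ip M i p (nabla M i (\<lambda>q. frame M i q a) p v) (frame M i p b) =
    - ip M i p (nabla M i (\<lambda>q. frame M i q b) p v) (frame M i p a)"
proof -
  define e where "e a x = frame M i (inv_chart M i x) a" for a x
  define e' where "e' a = deriv_in M i (\<lambda>q. frame M i q a) p" for a
  define G where "G x = metric M i (inv_chart M i x)" for x
  define G' where "G' = deriv_in M i (metric M i) p"
  let ?x = "chart M i p"
  let ?C = "christoffel M i p v"
  have e: "(e a has_derivative e' a) (at ?x)" for a
    unfolding e_def e'_def by (rule has_derivative_deriv_in[OF metric_frame_smooth(2)])
  have G: "(G has_derivative G') (at ?x)"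
    unfolding G_def G'_def by (rule has_derivative_deriv_in[OF metric_frame_smooth(1)])
  have at_p: "e a ?x = frame M i p a" "G ?x = metric M i p" for a
    by (simp_all add: e_def G_def inv_chart_chart p)
  note Ge = bounded_bilinear.FDERIV[OF bounded_bilinear_matrix_vector G]
  \<comment> \<open>For fixed \<open>u\<close> and \<open>w\<close>, metric compatibility gives the derivative of the metric matrix.\<close>
  have compat: "u \<bullet> (G' v *v w) = ip M i p (?C u) w + ip M i p u (?C w)" for u w
  proof -
    have "((\<lambda>x. u \<bullet> (G x *v w)) has_derivative (\<lambda>h. u \<bullet> (G' h *v w))) (at ?x)"
      by (rule has_derivative_inner_right, rule has_derivative_eq_rhs[OF Ge[OF has_derivative_const]])
        simp
    then have "deriv_in M i (\<lambda>q. ip M i q u w) p = (\<lambda>h. u \<bullet> (G' h *v w))"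
      by (intro deriv_in_eqI) (simp add: ip_def G_def)
    then show ?thesis
      by (metis deriv_metric)
  qed
  have "((\<lambda>x. e a x \<bullet> (G x *v e b x)) has_derivative
      (\<lambda>h. e a ?x \<bullet> (G ?x *v e' b h + G' h *v e b ?x) + e' a h \<bullet> (G ?x *v e b ?x))) (at ?x)"
    by (rule has_derivative_inner[OF e Ge[OF e]])
  moreover have "((\<lambda>x. e a x \<bullet> (G x *v e b x)) has_derivative (\<lambda>h. 0)) (at ?x)"
    using has_derivative_cong_patch[where f = "\<lambda>q. if a = b then 1 else 0" and D = "\<lambda>h. 0"
        and h = "\<lambda>q. ip M i q (frame M i q a) (frame M i q b)"]
    by (simp add: ip_frame[OF M]) (simp add: ip_def e_def G_def)
  ultimately have "(\<lambda>h. e a ?x \<bullet> (G ?x *v e' b h + G' h *v e b ?x) + e' a h \<bullet> (G ?x *v e b ?x)) = (\<lambda>h. 0)"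
    by (rule has_derivative_unique)
  from fun_cong[OF this, of v]
  have "e a ?x \<bullet> (G ?x *v e' b v + G' v *v e b ?x) + e' a v \<bullet> (G ?x *v e b ?x) = 0" .
  then have "ip M i p (frame M i p a) (e' b v) + ip M i p (e' a v) (frame M i p b)
      + (ip M i p (?C (frame M i p a)) (frame M i p b) + ip M i p (frame M i p a) (?C (frame M i p b))) = 0"
    by (simp add: at_p inner_add_right compat flip: ip_def)
  then show ?thesis
    by (simp add: nabla_def e'_def linear_add[OF linear_ip(2)] ip_commute[OF M p, of "frame M i p a"])
qed

lemma spin_conn_skew: "x \<bullet> (spin_conn M i p v *v x) = 0"
proof -
  have "Re (line_conn M i p v) = 0"
    using M p by (simp add: riemannian_spinc_manifold_def line_bundle_connection_def)
  then show ?thesis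
    unfolding spin_conn_def
    by (intro spin_connection_skew[OF spinor_module_spin_rep[OF M] nabla_frame_skew])
qed

lemma cmult_nabla_frame:
  "cmult M i p (nabla M i (\<lambda>q. frame M i q a) p v) x =
    spin_conn M i p v *v (spin_rep M a *v x) - spin_rep M a *v (spin_conn M i p v *v x)"
  unfolding spin_conn_def
  by (subst spin_connection_generator[OF spinor_module_spin_rep[OF M] nabla_frame_skew])
    (simp add: cmult_eq clif_apply frame_coords_def)

context
  fixes \<phi> :: "('m, 'i, 's) spinor_field" and A :: "('m, 'i, 'n) endo_field"
  assumes killing: "\<And>v. spin_nabla M \<phi> i p v = \<i> *s cmult M i p (A i p *v v) (\<phi> i p)"
begin

lemma deriv_spinor:
  "deriv_in M i (\<phi> i) p v = \<i> *s cmult M i p (A i p *v v) (\<phi> i p) - spin_conn M i p v *v \<phi> i p"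
  using killing[of v] by (simp add: spin_nabla_def algebra_simps)

text \<open>
  Half the derivative of \<open>|\<phi>|\<^sup>2\<close>: the connection form is skew and drops out, and what the Killing
  equation leaves is a pairing with the Dirac current.
\<close>

lemma spinor_inner_deriv:
  "\<phi> i p \<bullet> deriv_in M i (\<phi> i) p v = - ip M i p (dirac_current M \<phi> i p) (A i p *v v)"
  unfolding deriv_spinor inner_diff_right spin_conn_skew ip_dirac_current[OF M p] by (simp add: smult_i_skew)

context
  assumes smooth: "smooth_in M i (patch M i) (\<phi> i)"
    and type_I: "type_I M \<phi>" and nz: "\<phi> i p \<noteq> 0"
begin

text \<open>
  Differentiate \<open>E\<cdot>\<phi> = i\<phi>\<close> covariantly. In components this is \<open>\<Sum>\<^sub>a \<epsilon>\<^sub>a c\<^sub>a \<phi> = i\<phi>\<close> with differentiable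
  coefficients \<open>\<epsilon>\<^sub>a\<close>, so only ordinary derivatives occur, and the connection forms are restored
  afterwards with \<open>cmult_nabla_frame\<close>. Then \<open>\<nabla>\<^sub>X\<phi> = i a\<cdot>\<phi>\<close> is inserted, \<open>E\<close> is moved past \<open>a\<close>, and
  \<open>\<phi> \<noteq> 0\<close> is cancelled.
\<close>

lemma nabla_unit_normal:
  fixes v :: "real ^ 'n"
  defines "E \<equiv> unit_normal M (dirac_current M \<phi>)"
  shows "nabla M i (E i) p v = 2 *\<^sub>R (ip M i p (E i p) (A i p *v v) *\<^sub>R E i p - A i p *v v)"
proof -
  let ?x = "chart M i p"
  let ?s0 = "\<phi> i p"
  let ?\<Omega> = "spin_conn M i p v"
  let ?c = "spin_rep M"
  let ?a = "A i p *v v"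
  define s where "s x = \<phi> i (inv_chart M i x)" for x
  define s' where "s' = deriv_in M i (\<phi> i) p"
  define e where "e a x = frame M i (inv_chart M i x) a" for a x
  define e' where "e' a = deriv_in M i (\<lambda>q. frame M i q a) p" for a
  define \<epsilon> where "\<epsilon> a x = ((\<i> *s s x) \<bullet> (?c a *v s x)) / (s x \<bullet> s x)" for a x
  have s: "(s has_derivative s') (at ?x)"
    unfolding s_def s'_def by (rule has_derivative_deriv_in[OF smooth])
  have e: "(e a has_derivative e' a) (at ?x)" for a
    unfolding e_def e'_def by (rule has_derivative_deriv_in[OF metric_frame_smooth(2)])
  have at_p: "s ?x = ?s0" "e a ?x = frame M i p a" for a
    by (simp_all add: e_def s_def inv_chart_chart p)
  have bl_i: "bounded_linear ((*s) \<i> :: complex ^ 's \<Rightarrow> complex ^ 's)"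
    using linear_smult_i by (simp add: linear_conv_bounded_linear)
  have bl_c: "bounded_linear (\<lambda>x. ?c a *v x)" for a
    by (simp add: linear_conv_bounded_linear[symmetric])
  have "\<epsilon> a differentiable (at ?x)" for a
    unfolding \<epsilon>_def[abs_def] differentiable_def using nz at_p(1)
    by (auto intro!: exI derivative_eq_intros has_derivative_inner bounded_linear.has_derivative[OF bl_i]
        bounded_linear.has_derivative[OF bl_c] s)
  then obtain \<epsilon>' where \<epsilon>: "\<And>a. (\<epsilon> a has_derivative \<epsilon>' a) (at ?x)"
    unfolding differentiable_def by metis
  have E_frame: "E i q = (\<Sum>a\<in>UNIV. (((\<i> *s \<phi> i q) \<bullet> (?c a *v \<phi> i q)) / (\<phi> i q \<bullet> \<phi> i q)) *\<^sub>R frame M i q a)"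
    if "q \<in> patch M i" for q
    by (simp add: E_def unit_normal_eq[OF M that type_I] dirac_current_eq[OF M that] scaleR_sum_right
        power2_norm_eq_inner)
  have cE: "(\<Sum>a\<in>UNIV. (((\<i> *s \<phi> i q) \<bullet> (?c a *v \<phi> i q)) / (\<phi> i q \<bullet> \<phi> i q)) *\<^sub>R (?c a *v \<phi> i q)) = \<i> *s \<phi> i q"
    if "q \<in> patch M i" for q
    using cmult_unit_normal[OF M that type_I] unfolding E_def[symmetric] E_frame[OF that]
    by (simp add: linear_sum[OF linear_cmult] linear_scale[OF linear_cmult] cmult_frame[OF M that])
  have "((\<lambda>x. \<Sum>a\<in>UNIV. \<epsilon> a x *\<^sub>R e a x) has_derivative
      (\<lambda>h. \<Sum>a\<in>UNIV. \<epsilon> a ?x *\<^sub>R e' a h + \<epsilon>' a h *\<^sub>R e a ?x)) (at ?x)"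
    by (intro has_derivative_sum has_derivative_scaleR \<epsilon> e)
  then have "deriv_in M i (E i) p = (\<lambda>h. \<Sum>a\<in>UNIV. \<epsilon> a ?x *\<^sub>R e' a h + \<epsilon>' a h *\<^sub>R e a ?x)"
    by (intro deriv_in_eqI has_derivative_cong_patch[OF _ E_frame[symmetric]])
      (simp_all add: \<epsilon>_def s_def e_def)
  moreover have "E i p = (\<Sum>a\<in>UNIV. \<epsilon> a ?x *\<^sub>R frame M i p a)"
    using E_frame[OF p] by (simp add: \<epsilon>_def at_p)
  ultimately have nabla_E: "nabla M i (E i) p v =
      (\<Sum>a\<in>UNIV. \<epsilon>' a v *\<^sub>R frame M i p a) + (\<Sum>a\<in>UNIV. \<epsilon> a ?x *\<^sub>R nabla M i (\<lambda>q. frame M i q a) p v)"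
    by (simp add: nabla_def e'_def at_p linear_sum[OF linear_christoffel] linear_scale[OF linear_christoffel]
        sum.distrib algebra_simps)
  have "((\<lambda>x. \<Sum>a\<in>UNIV. \<epsilon> a x *\<^sub>R (?c a *v s x)) has_derivative
      (\<lambda>h. \<Sum>a\<in>UNIV. \<epsilon> a ?x *\<^sub>R (?c a *v s' h) + \<epsilon>' a h *\<^sub>R (?c a *v s ?x))) (at ?x)"
    by (intro has_derivative_sum has_derivative_scaleR \<epsilon> bounded_linear.has_derivative[OF bl_c] s)
  moreover have "((\<lambda>x. \<Sum>a\<in>UNIV. \<epsilon> a x *\<^sub>R (?c a *v s x)) has_derivative (\<lambda>h. \<i> *s s' h)) (at ?x)"
    using has_derivative_cong_patch[OF bounded_linear.has_derivative[OF bl_i s, unfolded s_def] cE[symmetric]]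
    by (simp add: \<epsilon>_def s_def)
  ultimately have "(\<lambda>h. \<Sum>a\<in>UNIV. \<epsilon> a ?x *\<^sub>R (?c a *v s' h) + \<epsilon>' a h *\<^sub>R (?c a *v s ?x)) = (\<lambda>h. \<i> *s s' h)"
    by (rule has_derivative_unique)
  \<comment> \<open>the unknown derivatives \<open>\<epsilon>\<^sub>a'\<close>, which also occur in \<open>\<nabla>E\<close>, expressed through the derivative of \<open>\<phi>\<close>\<close>
  then have der: "(\<Sum>a\<in>UNIV. \<epsilon>' a v *\<^sub>R (?c a *v ?s0)) = \<i> *s s' v - (\<Sum>a\<in>UNIV. \<epsilon> a ?x *\<^sub>R (?c a *v s' v))"
    by (simp add: fun_eq_iff at_p sum.distrib algebra_simps eq_diff_eq)
  have cE_apply: "(\<Sum>a\<in>UNIV. \<epsilon> a ?x *\<^sub>R (?c a *v x)) = cmult M i p (E i p) x" for x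
    unfolding E_frame[OF p]
    by (simp add: linear_sum[OF linear_cmult] linear_scale[OF linear_cmult] cmult_frame[OF M p] \<epsilon>_def at_p)
  have Es: "cmult M i p (E i p) ?s0 = \<i> *s ?s0"
    unfolding E_def by (rule cmult_unit_normal[OF M p type_I])
  have "cmult M i p (nabla M i (E i) p v) ?s0 =
      \<i> *s s' v - cmult M i p (E i p) (s' v)
      + ?\<Omega> *v (cmult M i p (E i p) ?s0) - cmult M i p (E i p) (?\<Omega> *v ?s0)"
    unfolding nabla_E linear_add[OF linear_cmult] linear_sum[OF linear_cmult] linear_scale[OF linear_cmult]
      cmult_frame[OF M p] cmult_nabla_frame der cE_apply[symmetric]
    by (simp add: matrix_vector_sum_right matrix_vector_scaleR_right scaleR_diff_right sum_subtractf)
  also have "\<dots> = \<i> *s (s' v + ?\<Omega> *v ?s0) - cmult M i p (E i p) (s' v + ?\<Omega> *v ?s0)"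
    unfolding Es matrix_smult_i by (simp add: cmult_eq linear_add[OF linear_smult_i] matrix_vector_right_distrib)
  also have "s' v + ?\<Omega> *v ?s0 = \<i> *s cmult M i p ?a ?s0"
    by (simp add: s'_def deriv_spinor)
  also have "\<i> *s (\<i> *s cmult M i p ?a ?s0) - cmult M i p (E i p) (\<i> *s cmult M i p ?a ?s0) =
      cmult M i p (2 *\<^sub>R (ip M i p (E i p) ?a *\<^sub>R E i p - ?a)) ?s0"
    by (simp add: smult_i_smult_i cmult_smult_i cmult_anticommute[OF M p, of "E i p" ?a] Es smult_i_diff smult_i_scaleR
        linear_neg[OF linear_smult_i] linear_diff[OF linear_cmult] linear_scale[OF linear_cmult])
      (simp add: vec_eq_iff algebra_simps scaleR_conv_of_real)
  finally have "cmult M i p (nabla M i (E i) p v - 2 *\<^sub>R (ip M i p (E i p) ?a *\<^sub>R E i p - ?a)) ?s0 = 0"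
    by (simp add: linear_diff[OF linear_cmult])
  from cmult_eq_0[OF M p this nz] show ?thesis by simp
qed

lemma weingarten_eq:
  fixes v :: "real ^ 'n"
  defines "E \<equiv> unit_normal M (dirac_current M \<phi>)"
  shows "weingarten M (dirac_current M \<phi>) i p v =
    2 *\<^sub>R (A i p *v v - ip M i p (E i p) (A i p *v v) *\<^sub>R E i p)"
proof -
  have E: "ip M i p (E i p) (E i p) = 1"
    unfolding E_def by (rule ip_unit_normal_self[OF M p type_I nz])
  show ?thesis
    unfolding weingarten_def Let_def E_def[symmetric] nabla_unit_normal[folded E_def]
    by (simp add: linear_diff[OF linear_ip(2)] linear_scale[OF linear_ip(2)] E
        ip_commute[OF M p, of "A i p *v v"] algebra_simps)
qed

text \<open>
  With \<open>a = A(v)\<close> and up to the common factor \<open>1/|\<phi>|\<close>, the derivative of \<open>1/|\<phi>|\<close> contributes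
  \<open>g(E,a)\<phi>\<close>, the Killing equation \<open>i a\<cdot>\<phi>\<close>, and the Weingarten term \<open>- i a\<cdot>\<phi> - g(E,a)\<phi>\<close>. The direction \<open>v\<close> is arbitrary, so the statement is an identity
  on the manifold, and a leaf enters only through the chain rule.
\<close>

lemma
  fixes v :: "real ^ 'n"
  shows normalized_parallel: "deriv_in M i (normalized \<phi> i) p v + spin_conn M i p v *v normalized \<phi> i p
    + (1 / 2) *\<^sub>R leaf_cmult M (dirac_current M \<phi>) i p
        (weingarten M (dirac_current M \<phi>) i p v) (normalized \<phi> i p) = 0"
    and normalized_has_derivative:
    "((\<lambda>x. normalized \<phi> i (inv_chart M i x)) has_derivative deriv_in M i (normalized \<phi> i) p) (at (chart M i p))"
proof -
  let ?x = "chart M i p"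
  let ?s0 = "\<phi> i p"
  let ?n = "norm ?s0"
  let ?a = "A i p *v v"
  define E where "E = unit_normal M (dirac_current M \<phi>) i p"
  define s where "s x = \<phi> i (inv_chart M i x)" for x
  define s' where "s' = deriv_in M i (\<phi> i) p"
  have s: "(s has_derivative s') (at ?x)"
    unfolding s_def s'_def by (rule has_derivative_deriv_in[OF smooth])
  have at_p: "s ?x = ?s0" by (simp add: s_def inv_chart_chart p)
  \<comment> \<open>also at zeros, as \<open>0 powr (- 1 / 2) = 0 = inverse 0\<close>\<close>
  have norm_eq: "normalized \<phi> i q = inverse (norm (\<phi> i q)) *\<^sub>R \<phi> i q" for q
    by (cases "\<phi> i q = 0") (simp_all add: normalized_def hprod_self powr_minus powr_half_sqrt)
  have "((\<lambda>x. norm (s x)) has_derivative (\<lambda>h. sgn ?s0 \<bullet> s' h)) (at ?x)"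
    using has_derivative_compose[OF s has_derivative_norm] nz by (simp add: at_p inner_commute)
  from Deriv.has_derivative_inverse[OF _ this] nz
  have inv: "((\<lambda>x. inverse (norm (s x))) has_derivative
      (\<lambda>h. - (inverse ?n * (sgn ?s0 \<bullet> s' h) * inverse ?n))) (at ?x)"
    by (simp add: at_p)
  from has_derivative_scaleR[OF inv s]
  have D: "((\<lambda>x. normalized \<phi> i (inv_chart M i x)) has_derivative
      (\<lambda>h. inverse ?n *\<^sub>R s' h + (- (inverse ?n * (sgn ?s0 \<bullet> s' h) * inverse ?n)) *\<^sub>R ?s0)) (at ?x)"
    by (simp add: norm_eq s_def inv_chart_chart p)
  note deriv = deriv_in_eqI[OF D]
  show "((\<lambda>x. normalized \<phi> i (inv_chart M i x)) has_derivative deriv_in M i (normalized \<phi> i) p) (at ?x)"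
    unfolding deriv by (rule D)
  have V: "dirac_current M \<phi> i p = ?n\<^sup>2 *\<^sub>R E"
    using nz by (simp add: E_def unit_normal_eq[OF M p type_I])
  have 0: "sgn ?s0 \<bullet> s' v = - ?n * ip M i p E ?a"
    using nz by (simp add: sgn_div_norm s'_def spinor_inner_deriv V linear_scale[OF linear_ip(2)] power2_eq_square)
  then have 1: "deriv_in M i (normalized \<phi> i) p v =
      inverse ?n *\<^sub>R (\<i> *s cmult M i p ?a ?s0 - spin_conn M i p v *v ?s0 + ip M i p E ?a *\<^sub>R ?s0)"
    unfolding deriv 0 using nz by (simp add: s'_def deriv_spinor algebra_simps)
  have Es: "cmult M i p E ?s0 = \<i> *s ?s0"
    unfolding E_def by (rule cmult_unit_normal[OF M p type_I])
  have "(1 / 2) *\<^sub>R leaf_cmult M (dirac_current M \<phi>) i p (weingarten M (dirac_current M \<phi>) i p v) ?s0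
      = cmult M i p E (cmult M i p (?a - ip M i p E ?a *\<^sub>R E) ?s0)"
    unfolding weingarten_eq leaf_cmult_def E_def[symmetric]
    by (simp add: linear_scale[OF linear_cmult] cmult_scaleR)
  also have "\<dots> = cmult M i p E (cmult M i p ?a ?s0) - ip M i p E ?a *\<^sub>R (\<i> *s (\<i> *s ?s0))"
    by (simp add: linear_diff[OF linear_cmult] linear_scale[OF linear_cmult] Es cmult_smult_i
        cmult_eq[of _ _ _ E "_ - _"] matrix_vector_mult_diff_distrib matrix_vector_scaleR_right flip: cmult_eq)
  also have "\<dots> = - (\<i> *s cmult M i p ?a ?s0) - ip M i p E ?a *\<^sub>R ?s0"
    unfolding cmult_anticommute[OF M p, of E ?a] Es by (simp add: cmult_smult_i smult_i_smult_i) (simp add: vec_eq_iff algebra_simps scaleR_conv_of_real)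
  finally have "inverse ?n *\<^sub>R ((1 / 2) *\<^sub>R leaf_cmult M (dirac_current M \<phi>) i p (weingarten M (dirac_current M \<phi>) i p v) ?s0)
      = inverse ?n *\<^sub>R (- (\<i> *s cmult M i p ?a ?s0) - ip M i p E ?a *\<^sub>R ?s0)"
    by (rule arg_cong)
  then show "deriv_in M i (normalized \<phi> i) p v + spin_conn M i p v *v normalized \<phi> i p
    + (1 / 2) *\<^sub>R leaf_cmult M (dirac_current M \<phi>) i p
        (weingarten M (dirac_current M \<phi>) i p v) (normalized \<phi> i p) = 0"
    by (simp add: 1 norm_eq leaf_cmult_def cmult_scaleR matrix_vector_scaleR_right algebra_simps)
qed

end

end

end

end

section \<open>Half spinors\<close>

lemma volume_element_clif:
  fixes c :: "'n::{finite,linorder} \<Rightarrow> complex ^ 's ^ 's"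
  assumes "spinor_module c" and "even CARD('n)"
  shows "volume_element c *v (clif c u *v x) = - (clif c u *v (volume_element c *v x))"
  by (simp add: clif_apply matrix_vector_sum_right matrix_vector_scaleR_right volume_element_anticommute[OF assms] sum_negf)

lemma linear_plus_part: "linear (plus_part c)"
  by (rule linearI)
    (simp_all add: plus_part_def matrix_vector_right_distrib matrix_vector_scaleR_right algebra_simps)

context
  fixes M :: "('m::{t2_space,second_countable_topology}, 'i, 'n::{finite,linorder}, 's::finite) spinc_manifold"
  assumes M: "riemannian_spinc_manifold M"
begin

text \<open>
  In even dimension \<open>R\<close> is the projection to the positive half spinors; it commutes with products of two
  generators because the volume element anticommutes with each. In odd dimension \<open>R\<close> is the identity.
  Both cases are used only through these properties.
\<close>

lemma leaf_restriction_projection: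
  obtains R :: "complex ^ 's \<Rightarrow> complex ^ 's" where "bounded_linear R"
    and "\<And>\<psi> i p. leaf_restriction M \<psi> i p = R (\<psi> i p)"
    and "\<And>i p v x. spin_conn M i p v *v R x = R (spin_conn M i p v *v x)"
    and "\<And>V i p v x. leaf_cmult M V i p v (R x) = R (leaf_cmult M V i p v x)"
proof (cases "odd CARD('n)")
  case True
  then show thesis
    by (intro that[of "\<lambda>x. x"]) (simp_all add: leaf_restriction_def)
next
  case False
  note anti = volume_element_anticommute[OF spinor_module_spin_rep[OF M]]
    volume_element_clif[OF spinor_module_spin_rep[OF M]]
  let ?R = "plus_part (spin_rep M)"
  show thesis
  proof (rule that[of ?R])
    show "bounded_linear ?R"
      by (simp add: linear_plus_part flip: linear_conv_bounded_linear)
    show "leaf_restriction M \<psi> i p = ?R (\<psi> i p)" for \<psi> i p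
      using False by (simp add: leaf_restriction_def)
    show "spin_conn M i p v *v ?R x = ?R (spin_conn M i p v *v x)" for i p v x
    proof -
      have "volume_element (spin_rep M) *v (spin_conn M i p v *v x) =
          spin_conn M i p v *v (volume_element (spin_rep M) *v x)"
        using False
        by (simp add: spin_conn_def matrix_vector_mult_add_rdistrib matrix_vector_scaleR_left matrix_vector_sum_left
            matrix_vector_right_distrib matrix_vector_scaleR_right matrix_vector_sum_right mat_smult anti vec.neg
            vector_scalar_commute flip: matrix_vector_mul_assoc)
      then show ?thesis
        by (simp add: plus_part_def matrix_vector_scaleR_right matrix_vector_right_distrib)
    qed
    show "leaf_cmult M V i p v (?R x) = ?R (leaf_cmult M V i p v x)" for V i p v x
      using False
      by (simp add: leaf_cmult_def plus_part_def cmult_eq anti vec.neg matrix_vector_scaleR_right matrix_vector_right_distrib)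
  qed
qed

end

section \<open>The zero set of a generalized Killing spinor\<close>

text \<open>
  A variant of Gronwall's lemma: on a ball around \<open>x0\<close> of radius at most \<open>1 / (2C)\<close>, where \<open>C\<close> bounds \<open>K\<close>, the
  mean value inequality bounds the maximum of \<open>f\<close> by half of itself.
\<close>

lemma vanishes_near_zero:
  fixes f :: "'a::euclidean_space \<Rightarrow> real"
  assumes S: "open S" "x0 \<in> S" and "f x0 = 0"
    and nonneg: "\<And>x. x \<in> S \<Longrightarrow> 0 \<le> f x"
    and deriv: "\<And>x. x \<in> S \<Longrightarrow> (f has_derivative f' x) (at x)"
    and K: "continuous_on S K"
    and bound: "\<And>x v. x \<in> S \<Longrightarrow> \<bar>f' x v\<bar> \<le> K x * f x * norm v"
  obtains r where "r > 0" "ball x0 r \<subseteq> S" "\<And>x. x \<in> ball x0 r \<Longrightarrow> f x = 0"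
proof -
  obtain r1 where r1: "r1 > 0" "cball x0 r1 \<subseteq> S"
    using S open_contains_cball by blast
  have "bounded (K ` cball x0 r1)"
    using K r1 by (intro compact_imp_bounded compact_continuous_image) (auto intro: continuous_on_subset)
  then obtain C where C: "C > 0" "\<And>x. x \<in> cball x0 r1 \<Longrightarrow> \<bar>K x\<bar> \<le> C"
    unfolding bounded_pos by auto
  define r where "r = min r1 (1 / (2 * C))"
  have "C * r \<le> C * (1 / (2 * C))"
    using C(1) by (intro mult_left_mono) (simp_all add: r_def)
  then have r: "r > 0" "cball x0 r \<subseteq> cball x0 r1" "C * r \<le> 1 / 2"
    using r1(1) C(1) by (simp_all add: r_def subset_cball)
  have sub: "cball x0 r \<subseteq> S" using r(2) r1(2) by blast
  have "continuous_on (cball x0 r) f"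
    using deriv sub by (meson continuous_at_imp_continuous_on has_derivative_continuous subsetD)
  then obtain z where z: "z \<in> cball x0 r" "\<And>x. x \<in> cball x0 r \<Longrightarrow> f x \<le> f z"
    using continuous_attains_sup[of "cball x0 r" f] r(1) by force
  have "norm (f z - f x0) \<le> (C * f z) * norm (z - x0)"
  proof (rule differentiable_bound[OF convex_cball])
    show "(f has_derivative f' x) (at x within cball x0 r)" if "x \<in> cball x0 r" for x
      using deriv sub that by (blast intro: has_derivative_at_withinI)
    show "onorm (f' x) \<le> C * f z" if x: "x \<in> cball x0 r" for x
    proof (rule onorm_bound)
      show "0 \<le> C * f z" using C(1) nonneg z(1) sub by auto
      have "K x * f x \<le> C * f z"
        using C(1) C(2)[of x] nonneg[of x] x r(2) sub z(2)[OF x] by (intro mult_mono) auto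
      then have "K x * f x * norm v \<le> C * f z * norm v" for v :: 'a
        by (rule mult_right_mono) simp
      then show "norm (f' x v) \<le> C * f z * norm v" for v
        using bound[of x v] x sub by (simp add: subset_iff) (meson order_trans)
    qed
  qed (use z r in auto)
  also have "\<dots> \<le> (C * f z) * r"
    using z C(1) nonneg sub by (intro mult_left_mono) (auto simp: dist_norm norm_minus_commute)
  also have "\<dots> \<le> f z * (1 / 2)"
    using mult_left_mono[OF r(3), of "f z"] nonneg[of z] z(1) sub by (auto simp: algebra_simps)
  finally have "f z \<le> 0" using \<open>f x0 = 0\<close> by simp
  then have "f x = 0" if "x \<in> ball x0 r" for x
    using z(2)[of x] nonneg[of x] sub that by force
  then show thesis using that r(1) sub by (meson ball_subset_cball subset_trans)
qed

context
  fixes M :: "('m::{t2_space,second_countable_topology}, 'i, 'n::finite, 's::finite) spinc_manifold"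
    and \<phi> :: "('m, 'i, 's) spinor_field"
  assumes killing: "imaginary_generalized_killing M \<phi>"
begin

lemma spinor_smooth: "smooth_in M i (patch M i) (\<phi> i)"
  and spinor_transition: "p \<in> patch M i \<inter> patch M j \<Longrightarrow> \<phi> i p = spinc_trans M i j p *v \<phi> j p"
  using killing by (auto simp: imaginary_generalized_killing_def spinor_section_def)

lemma spinor_zero_transition:
  assumes "p \<in> patch M i" "p \<in> patch M j" shows "\<phi> i p = 0 \<longleftrightarrow> \<phi> j p = 0"
  using spinor_transition[of p i j] spinor_transition[of p j i] assms by auto

lemma generalized_killing_endomorphism:
  obtains A where "\<And>i. smooth_in M i (patch M i) (A i)"
    and "\<And>i p v. p \<in> patch M i \<Longrightarrow> spin_nabla M \<phi> i p v = \<i> *s cmult M i p (A i p *v v) (\<phi> i p)"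
proof -
  obtain A where "symmetric_endo_field M A"
    and "\<forall>i. \<forall>p \<in> patch M i. \<forall>v. spin_nabla M \<phi> i p v = \<i> *s cmult M i p (A i p *v v) (\<phi> i p)"
    using killing unfolding imaginary_generalized_killing_def by blast
  then show thesis
    by (intro that[of A]) (simp_all add: symmetric_endo_field_def)
qed

context
  assumes M: "riemannian_spinc_manifold M"
begin

text \<open>
  Zeros propagate since \<open>f = |\<phi>|\<^sup>2\<close> satisfies a linear differential inequality. Estimating \<open>f\<close> rather than
  \<open>\<phi>\<close> removes the connection form, which is skew; what remains involves only the endomorphism field
  and the metric, which are continuous and hence locally bounded.
\<close>

lemma zero_near_zero:
  assumes p: "p \<in> patch M i" and zero: "\<phi> i p = 0"
  obtains W where "open W" "p \<in> W" "W \<subseteq> patch M i" "\<And>q. q \<in> W \<Longrightarrow> \<phi> i q = 0"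
proof -
  obtain A where A: "\<And>i. smooth_in M i (patch M i) (A i)"
    and eq: "\<And>i q v. q \<in> patch M i \<Longrightarrow> spin_nabla M \<phi> i q v = \<i> *s cmult M i q (A i q *v v) (\<phi> i q)"
    using generalized_killing_endomorphism by metis
  obtain C where C: "C > 0" "\<And>(B :: real ^ 'n ^ 'n) w. norm (B *v w) \<le> norm B * norm w * C"
    using bounded_bilinear.pos_bounded[OF bounded_bilinear_matrix_vector] by blast
  let ?S = "chart M i ` patch M i"
  let ?g = "inv_chart M i"
  define f where "f x = \<phi> i (?g x) \<bullet> \<phi> i (?g x)" for x
  define f' where "f' x v = - 2 * ip M i (?g x) (dirac_current M \<phi> i (?g x)) (A i (?g x) *v v)" for x v
  \<comment> \<open>\<open>C |A|\<close> bounds the Euclidean length of \<open>A(v)\<close>, and \<open>sqrt (C |g|)\<close> passes from there to the length for \<open>g\<close>.\<close>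
  define K where "K x = 2 * (norm (A i (?g x)) * C * sqrt (C * norm (metric M i (?g x))))" for x
  have K: "continuous_on ?S K"
    unfolding K_def
    by (intro continuous_intros smooth_in_continuous_on A metric_frame_smooth[OF M])
  have deriv: "(f has_derivative f' x) (at x)" if x: "x \<in> ?S" for x
  proof -
    obtain q where q: "q \<in> patch M i" "x = chart M i q" using x by blast
    note D = has_derivative_deriv_in[OF M q(1) spinor_smooth]
    show ?thesis
      unfolding f_def q(2)
      by (rule has_derivative_eq_rhs[OF has_derivative_inner[OF D D]])
        (simp add: fun_eq_iff f'_def inv_chart_chart[OF M q(1)] inner_commute
          spinor_inner_deriv[where \<phi> = \<phi> and A = A, OF M q(1) eq[OF q(1)]])
  qed
  have bound: "\<bar>f' x v\<bar> \<le> K x * f x * norm v" if x: "x \<in> ?S" for x v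
  proof -
    let ?q = "?g x"
    have q: "?q \<in> patch M i" using x by (rule inv_chart_mem[OF M])
    let ?w = "A i ?q *v v"
    have w: "norm ?w \<le> norm (A i ?q) * C * norm v" using C(2) by (simp add: ac_simps)
    have "ip M i ?q ?w ?w \<le> norm ?w * norm (metric M i ?q *v ?w)"
      unfolding ip_def by (rule norm_cauchy_schwarz)
    also have "\<dots> \<le> norm ?w * (norm (metric M i ?q) * norm ?w * C)"
      by (intro mult_left_mono C(2)) simp
    also have "\<dots> = (norm ?w)\<^sup>2 * (C * norm (metric M i ?q))"
      by (simp add: power2_eq_square)
    finally have "sqrt (ip M i ?q ?w ?w) \<le> sqrt ((norm ?w)\<^sup>2 * (C * norm (metric M i ?q)))"
      by (rule real_sqrt_le_mono)
    also have "\<dots> = norm ?w * sqrt (C * norm (metric M i ?q))"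
      by (simp add: real_sqrt_mult)
    also have "\<dots> \<le> norm (A i ?q) * C * norm v * sqrt (C * norm (metric M i ?q))"
      using C(1) by (intro mult_right_mono w) simp
    finally have w2: "2 * sqrt (ip M i ?q ?w ?w) \<le> K x * norm v"
      by (simp add: K_def mult_ac)
    have "\<bar>f' x v\<bar> = 2 * \<bar>(\<i> *s \<phi> i ?q) \<bullet> cmult M i ?q ?w (\<phi> i ?q)\<bar>"
      by (simp add: f'_def abs_mult ip_dirac_current[OF M q])
    also have "\<dots> \<le> 2 * (norm (\<i> *s \<phi> i ?q) * norm (cmult M i ?q ?w (\<phi> i ?q)))"
      using Cauchy_Schwarz_ineq2 by simp
    also have "norm (\<i> *s \<phi> i ?q) = norm (\<phi> i ?q)"
      by (simp add: norm_eq_sqrt_inner smult_i_skew smult_i_smult_i)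
    also have "2 * (norm (\<phi> i ?q) * norm (cmult M i ?q ?w (\<phi> i ?q))) =
        2 * sqrt (ip M i ?q ?w ?w) * f x"
      by (simp add: f_def norm_cmult[OF M q] power2_eq_square flip: power2_norm_eq_inner)
    also have "\<dots> \<le> (K x * norm v) * f x"
      by (intro mult_right_mono w2) (simp add: f_def)
    finally show ?thesis by (simp add: mult_ac)
  qed
  obtain r where r: "r > 0" "ball (chart M i p) r \<subseteq> ?S" "\<And>x. x \<in> ball (chart M i p) r \<Longrightarrow> f x = 0"
    by (rule vanishes_near_zero[OF open_chart_image[OF M] _ _ _ deriv K bound, of "chart M i p"])
      (use p zero in \<open>auto simp: f_def inv_chart_chart[OF M]\<close>)
  show thesis
  proof (rule that[of "patch M i \<inter> chart M i -` ball (chart M i p) r"])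
    show "open (patch M i \<inter> chart M i -` ball (chart M i p) r)"
      using homeomorphism_cont1[OF homeomorphism_chart[OF M]] open_patch[OF M]
      by (intro continuous_open_preimage) auto
    show "\<phi> i q = 0" if "q \<in> patch M i \<inter> chart M i -` ball (chart M i p) r" for q
      using r(3)[of "chart M i q"] that by (simp add: f_def inv_chart_chart[OF M])
  qed (use p r in auto)
qed

lemma nonzeros_open: "open {q \<in> patch M i. \<phi> i q \<noteq> 0}"
proof -
  have "continuous_on (patch M i) (\<lambda>q. \<phi> i (inv_chart M i (chart M i q)))"
    using smooth_in_continuous_on[OF spinor_smooth] homeomorphism_cont1[OF homeomorphism_chart[OF M]]
    by (rule continuous_on_compose2) auto
  then have "continuous_on (patch M i) (\<phi> i)"
    by (rule continuous_on_eq) (simp add: inv_chart_chart[OF M])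
  then have "open (patch M i \<inter> \<phi> i -` (- {0}))"
    by (rule continuous_open_preimage) (auto simp: open_patch[OF M])
  then show ?thesis by (simp add: vimage_def Collect_conj_eq)
qed

lemma nonzero_on_connected_component:
  assumes p: "p \<in> patch M i" and q: "q \<in> patch M j" and con: "connected_component UNIV p q"
    and nz: "\<phi> j q \<noteq> 0"
  shows "\<phi> i p \<noteq> 0"
proof
  assume zero: "\<phi> i p = 0"
  define Z where "Z = {x. \<exists>k. x \<in> patch M k \<and> \<phi> k x = 0}"
  define N where "N = (\<Union>k. {x \<in> patch M k. \<phi> k x \<noteq> 0})"
  have "open N" unfolding N_def using nonzeros_open by blast
  moreover have "open Z"
  proof (subst open_subopen, intro ballI)
    fix x assume "x \<in> Z"
    then obtain k where "x \<in> patch M k" "\<phi> k x = 0" by (auto simp: Z_def)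
    then obtain W where "open W" "x \<in> W" "W \<subseteq> patch M k" "\<And>y. y \<in> W \<Longrightarrow> \<phi> k y = 0"
      using zero_near_zero by metis
    then show "\<exists>T. open T \<and> x \<in> T \<and> T \<subseteq> Z" by (intro exI[of _ W]) (auto simp: Z_def)
  qed
  moreover have "Z \<union> N = UNIV"
  proof -
    have "x \<in> (\<Union>k. patch M k)" for x
      using M by (simp add: riemannian_spinc_manifold_def oriented_atlas_def)
    then show ?thesis by (force simp: Z_def N_def)
  qed
  moreover have "Z \<inter> N = {}"
    using spinor_zero_transition by (auto simp: Z_def N_def)
  moreover obtain T where "connected T" "p \<in> T" "q \<in> T"
    using con by (auto simp: connected_component_def)
  moreover have "p \<in> Z" "q \<in> N" using assms zero by (auto simp: Z_def N_def)
  ultimately show False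
    using connectedD[of T Z N] by blast
qed

end

end

section \<open>Plaques and the parallel spinor on the leaves\<close>

text \<open>
  A plaque has one dimension less than the manifold, so its tangent spaces are proper subspaces; at a
  zero of \<open>V\<close>, however, the orthogonal complement of \<open>V\<close> is the whole tangent space.
\<close>

lemma
  fixes M :: "('m::{t2_space,second_countable_topology}, 'i, 'n::finite, 's::finite) spinc_manifold"
    and \<sigma> :: "real ^ 'k::finite \<Rightarrow> 'm"
  assumes M: "riemannian_spinc_manifold M" and \<sigma>: "(B, \<sigma>) \<in> plaques M V" and u: "u \<in> B" "\<sigma> u \<in> patch M i"
  shows plaque_has_derivative: "((\<lambda>x. chart M i (\<sigma> x)) has_derivative push M \<sigma> i u) (at u)"
    and plaque_preimage_open: "open {x \<in> B. \<sigma> x \<in> patch M i}"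
    and plaque_normal_nonzero: "CARD('n) = CARD('k) + 1 \<Longrightarrow> V i (\<sigma> u) \<noteq> 0"
proof -
  have B: "open B" "continuous_on B \<sigma>" "smooth_on (chart M i \<circ> \<sigma>) {x \<in> B. \<sigma> x \<in> patch M i}"
    "range (push M \<sigma> i u) = {v. ip M i (\<sigma> u) (V i (\<sigma> u)) v = 0}"
    using \<sigma> u by (auto simp: plaques_def)
  have "open (B \<inter> \<sigma> -` patch M i)"
    using B open_patch[OF M] by (intro continuous_open_preimage)
  then show op: "open {x \<in> B. \<sigma> x \<in> patch M i}"
    by (simp add: vimage_def Collect_conj_eq)
  have "(chart M i \<circ> \<sigma>) differentiable (at u)"
    using smooth_on_imp_differentiable[OF B(3) op] u by simp
  moreover have "push M \<sigma> i u = frechet_derivative (chart M i \<circ> \<sigma>) (at u)"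
    by (simp add: push_def fun_eq_iff)
  ultimately show D: "((\<lambda>x. chart M i (\<sigma> x)) has_derivative push M \<sigma> i u) (at u)"
    by (simp add: frechet_derivative_works o_def)
  show "V i (\<sigma> u) \<noteq> 0" if "CARD('n) = CARD('k) + 1"
  proof
    assume "V i (\<sigma> u) = 0"
    then have "range (push M \<sigma> i u) = UNIV" using B(4) by (simp add: ip_def)
    then have "dim (UNIV :: (real ^ 'n) set) \<le> dim (UNIV :: (real ^ 'k) set)"
      using dim_image_le[OF has_derivative_linear[OF D], of UNIV] by simp
    then show False using that by simp
  qed
qed

theorem lemma21:
  fixes M :: "('m::{t2_space,second_countable_topology}, 'i, 'n::{finite,linorder}, 's::finite) spinc_manifold"
    and \<phi> :: "('m, 'i, 's) spinor_field"
    and P :: "('m, 'k::finite) plaque set"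
  assumes "riemannian_spinc_manifold M"
    and "imaginary_generalized_killing M \<phi>"
    and "type_I M \<phi>"
    and "CARD('n) = CARD('k) + 1"
    and "P = plaques M (dirac_current M \<phi>)"
  shows "(\<forall>i j. \<forall>p \<in> patch M i. \<forall>q \<in> patch M j.
            connected_component UNIV p q \<and> \<phi> j q \<noteq> 0 \<longrightarrow> dirac_current M \<phi> i p \<noteq> 0) \<and>
         (\<forall>p. parallel_on_leaf M (dirac_current M \<phi>) P (leaf P p)
                (leaf_restriction M (normalized \<phi>)))"
proof (intro conjI allI ballI impI)
  fix i j p q
  assume "p \<in> patch M i" "q \<in> patch M j" "connected_component UNIV p q \<and> \<phi> j q \<noteq> 0"
  then show "dirac_current M \<phi> i p \<noteq> 0"
    using nonzero_on_connected_component[OF assms(2,1)] dirac_current_eq_0[OF assms(1) _ assms(3)]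
    by blast
next
  fix p
  let ?V = "dirac_current M \<phi>"
  let ?\<eta> = "leaf_restriction M (normalized \<phi>)"
  obtain R where R: "bounded_linear R"
    and \<eta>: "\<And>\<psi> i q. leaf_restriction M \<psi> i q = R (\<psi> i q)"
    and R_conn: "\<And>i q v x. spin_conn M i q v *v R x = R (spin_conn M i q v *v x)"
    and R_cmult: "\<And>V i q v x. leaf_cmult M V i q v (R x) = R (leaf_cmult M V i q v x)"
    using leaf_restriction_projection[OF assms(1)] by blast
  obtain A where "\<And>i. smooth_in M i (patch M i) (A i)"
    and eq: "\<And>i q v. q \<in> patch M i \<Longrightarrow> spin_nabla M \<phi> i q v = \<i> *s cmult M i q (A i q *v v) (\<phi> i q)"
    using generalized_killing_endomorphism[OF assms(2)] by metis
  have "(\<lambda>x. ?\<eta> i (\<sigma> x)) differentiable (at u) \<and> (\<forall>w. leaf_nabla M ?V ?\<eta> \<sigma> i u w = 0)"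
    if \<sigma>: "(B, \<sigma>) \<in> plaques M ?V" and u: "u \<in> B" and q: "\<sigma> u \<in> patch M i"
    for B and \<sigma> :: "real ^ 'k \<Rightarrow> 'm" and u i
  proof -
    note plaque = plaque_has_derivative[OF assms(1) \<sigma> u q]
      plaque_preimage_open[OF assms(1) \<sigma> u q]
      plaque_normal_nonzero[OF assms(1) \<sigma> u q assms(4)]
    have nz: "\<phi> i (\<sigma> u) \<noteq> 0"
      using plaque(3) dirac_current_eq_0[OF assms(1) q assms(3)] by blast
    let ?D = "deriv_in M i (normalized \<phi> i) (\<sigma> u)"
    note D = normalized_has_derivative[where \<phi> = \<phi> and A = A,
        OF assms(1) q eq[OF q] spinor_smooth[OF assms(2)] assms(3) nz]
    have "((\<lambda>x. R (normalized \<phi> i (inv_chart M i (chart M i (\<sigma> x))))) has_derivative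
        (\<lambda>w. R (?D (push M \<sigma> i u w)))) (at u)"
      by (rule bounded_linear.has_derivative[OF R has_derivative_compose[OF plaque(1) D]])
    then have D\<eta>: "((\<lambda>x. ?\<eta> i (\<sigma> x)) has_derivative (\<lambda>w. R (?D (push M \<sigma> i u w)))) (at u)"
      by (rule has_derivative_transform_within_open[OF _ plaque(2)])
        (use u q in \<open>auto simp: \<eta> inv_chart_chart[OF assms(1)]\<close>)
    have "leaf_nabla M ?V ?\<eta> \<sigma> i u w = 0" for w
    proof -
      let ?v = "push M \<sigma> i u w"
      note par = normalized_parallel[where \<phi> = \<phi> and A = A and v = ?v,
          OF assms(1) q eq[OF q] spinor_smooth[OF assms(2)] assms(3) nz]
      have "leaf_nabla M ?V ?\<eta> \<sigma> i u w =
          R (?D ?v) + R (spin_conn M i (\<sigma> u) ?v *v normalized \<phi> i (\<sigma> u))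
          + (1 / 2) *\<^sub>R R (leaf_cmult M ?V i (\<sigma> u) (weingarten M ?V i (\<sigma> u) ?v) (normalized \<phi> i (\<sigma> u)))"
        by (simp add: leaf_nabla_def Let_def frechet_derivative_at[OF D\<eta>[unfolded \<eta>], symmetric] \<eta> R_conn R_cmult)
      also have "\<dots> = R 0"
        unfolding par[symmetric]
        by (simp add: linear_add[OF bounded_linear.linear[OF R]] linear_scale[OF bounded_linear.linear[OF R]])
      finally show ?thesis by (simp add: linear_0[OF bounded_linear.linear[OF R]])
    qed
    with D\<eta> show ?thesis by (auto simp: differentiable_def)
  qed
  then show "parallel_on_leaf M ?V P (leaf P p) ?\<eta>"
    unfolding parallel_on_leaf_def assms(5) by blast
qed

end
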